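(* Let $\mathcal T_{\mathbb Q}$, $\mathcal T_{\mathbb H}$, $\mathcal T_{\mathbb Z^2}$ be the self-avoiding trees of the first quadrant, half-plane and plane; they have a common critical value, denoted $\lambda_c$. The effective conductances $\mathcal C(\lambda,\mathcal T_{\mathbb Q})$, $\mathcal C(\lambda,\mathcal T_{\mathbb H})$ and $\mathcal C(\lambda,\mathcal T_{\mathbb Z^2})$ are continuous functions of $\lambda$ on the interval $(\lambda_c,+\infty)$.
   Context: $\mathbb H=\{(x,y)\in\mathbb Z^2: y\ge 0\}$ and $\mathbb Q=\{(x,y)\in\mathbb Z^2: x\ge 0,\ y\ge 0\}$, with nearest-neighbour edges. For $G\in\{\mathbb Z^2,\mathbb H,\mathbb Q\}$, the self-avoiding tree $\mathcal T_G$ is the tree whose vertices are the finite self-avoiding nearest-neighbour walks in $G$ starting at the origin $(0,0)$, two being adjacent when one is a one-step extension of the other; its root $o$ is the walk of length $0$. For $\lambda>0$ and an infinite, locally finite rooted tree $\mathcal T$ with root $o$, $RW_\lambda$ is the Markov chain on the vertices of $\mathcal T$ which, at a vertex $x\ne o$ with $k$ children, jumps to the parent of $x$ with probability $1/(1+k\lambda)$ and to each child with probability $\lambda/(1+k\lambda)$; from $o$ it jumps to a uniformly chosen child. The critical value $\lambda_c(\mathcal T)$ is such that $RW_\lambda$ is recurrent for $\lambda<\lambda_c(\mathcal T)$ and transient for $\lambda>\lambda_c(\mathcal T)$. For all three trees above, it equals $1/\mu$, where $\mu$ is the connective constant of $\mathbb Z^2$. Effective conductance: give each edge $(x,y)$,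 with $x$ the parent of $y$, the conductance $\lambda^{|x|}$, where $|x|$ is the distance from $x$ to the root; the associated network random walk is $RW_\lambda$. Then $\mathcal C(\lambda,\mathcal T)=\pi(o)\,\mathbb P(RW_\lambda\text{ started at }o\text{ never returns to }o)$, where $\pi(o)$ is the sum of conductances of edges at the root (i.e. the number of children of $o$). *)

theory Defs
  imports "HOL-Probability.Probability"
begin

section \<open>Self-avoiding trees\<close>

type_synonym site = "int \<times> int"

definition plane :: "site set" where
  "plane = UNIV"

definition half_plane :: "site set" where
  "half_plane = {p. snd p \<ge> 0}"

definition quadrant :: "site set" where
  "quadrant = {p. fst p \<ge> 0 \<and> snd p \<ge> 0}"

definition lattice_adj :: "site \<Rightarrow> site \<Rightarrow> bool" where
  "lattice_adj p q \<longleftrightarrow> \<bar>fst p - fst q\<bar> + \<bar>snd p - snd q\<bar> = 1"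

text \<open>A walk of length $n$ is the list of its $n + 1$ successive sites. The set of all self-avoiding
  walks is the vertex set of the tree; its edges are encoded by \<open>parent\<close> and \<open>children\<close> below.\<close>

definition saw_tree :: "site set \<Rightarrow> site list set" where
  "saw_tree G = {w. w \<noteq> [] \<and> hd w = (0, 0) \<and> set w \<subseteq> G \<and> distinct w \<and> successively lattice_adj w}"

definition tree_root :: "site list" where
  "tree_root = [(0, 0)]"

definition parent :: "site list \<Rightarrow> site list" where
  "parent w = butlast w"

definition children :: "site list set \<Rightarrow> site list \<Rightarrow> site list set" where
  "children T w = {w' \<in> T. \<exists>p. w' = w @ [p]}"

definition depth :: "site list \<Rightarrow> nat" where
  "depth w = length w - 1"

section \<open>Law of a Markov chain\<close>

definition path_kernel :: "('s \<Rightarrow> 's pmf) \<Rightarrow> 's \<Rightarrow> nat \<Rightarrow> (nat \<Rightarrow> 's) \<Rightarrow> 's measure" where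
  "path_kernel K x n \<omega> = measure_pmf (case n of 0 \<Rightarrow> return_pmf x | Suc m \<Rightarrow> K (\<omega> m))"

interpretation chain: Ionescu_Tulcea "path_kernel K x" "\<lambda>_. count_space UNIV"
  for K :: "'s \<Rightarrow> 's pmf" and x :: 's
proof (rule Ionescu_Tulcea.intro)
  fix i
  show "path_kernel K x i \<in> measurable (PiM {0..<i} (\<lambda>_. count_space UNIV)) (subprob_algebra (count_space UNIV))"
  proof (cases i)
    case 0
    then show ?thesis
      by (simp add: path_kernel_def[abs_def] measure_pmf_in_subprob_algebra)
  next
    case (Suc m)
    have "(\<lambda>\<omega>. \<omega> m) \<in> measurable (PiM {0..<i} (\<lambda>_. count_space UNIV)) (count_space (UNIV :: 's set))"
      using Suc by (intro measurable_component_singleton) auto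
    moreover have "(\<lambda>y. measure_pmf (K y)) \<in> measurable (count_space UNIV) (subprob_algebra (count_space UNIV))"
      by (auto simp: measure_pmf_in_subprob_algebra)
    ultimately show ?thesis
      using Suc by (simp add: path_kernel_def[abs_def])
  qed
next
  fix i and \<omega> :: "nat \<Rightarrow> 's"
  show "prob_space (path_kernel K x i \<omega>)"
    by (simp add: path_kernel_def measure_pmf.prob_space_axioms)
qed

text \<open>The law, on trajectories, of the chain with transition kernel \<open>K\<close> started at \<open>x\<close>
  (Ionescu-Tulcea extension).\<close>

definition markov_law :: "('s \<Rightarrow> 's pmf) \<Rightarrow> 's \<Rightarrow> (nat \<Rightarrow> 's) measure" where
  "markov_law K x = chain.PF.lim K x"

lemma space_markov_law [simp]: "space (markov_law K x) = UNIV"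
  by (simp add: markov_law_def space_PiM)

lemma sets_markov_law [measurable_cong]:
  "sets (markov_law K x) = sets (PiM UNIV (\<lambda>_. count_space UNIV))"
  by (simp add: markov_law_def)

section \<open>The random walk on a tree\<close>

definition rw_step :: "real \<Rightarrow> site list set \<Rightarrow> site list \<Rightarrow> site list pmf" where
  "rw_step lam T x =
     (if x = tree_root then pmf_of_set (children T tree_root)
      else embed_pmf (\<lambda>y. if y = parent x then 1 / (1 + real (card (children T x)) * lam)
                          else if y \<in> children T x then lam / (1 + real (card (children T x)) * lam)
                          else 0))"

definition rw_law :: "real \<Rightarrow> site list set \<Rightarrow> (nat \<Rightarrow> site list) measure" where
  "rw_law lam T = markov_law (rw_step lam T) tree_root"

definition recurrent :: "real \<Rightarrow> site list set \<Rightarrow> bool" where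
  "recurrent lam T \<longleftrightarrow> (AE \<omega> in rw_law lam T. \<exists>n\<ge>1. \<omega> n = tree_root)"

definition transient :: "real \<Rightarrow> site list set \<Rightarrow> bool" where
  "transient lam T \<longleftrightarrow> \<not> recurrent lam T"

definition is_critical_value :: "site list set \<Rightarrow> real \<Rightarrow> bool" where
  "is_critical_value T c \<longleftrightarrow>
     0 \<le> c \<and> (\<forall>lam>0. (lam < c \<longrightarrow> recurrent lam T) \<and> (lam > c \<longrightarrow> transient lam T))"

lemma is_critical_value_unique:
  assumes "is_critical_value T c" "is_critical_value T c'"
  shows "c = c'"
proof -
  have *: False if "is_critical_value T a" "is_critical_value T b" "a < b" for a b
  proof -
    have "recurrent ((a + b) / 2) T" "transient ((a + b) / 2) T"
      using that by (auto simp: is_critical_value_def)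
    then show False
      by (simp add: transient_def)
  qed
  show ?thesis
    using *[OF assms] *[OF assms(2,1)] by force
qed

section \<open>Effective conductance\<close>

text \<open>The edge joining \<open>y\<close> to its parent has conductance \<open>lam\<close> to the power of the depth of the parent.\<close>

definition edge_conductance :: "real \<Rightarrow> site list \<Rightarrow> real" where
  "edge_conductance lam y = lam ^ depth (parent y)"

definition total_conductance :: "real \<Rightarrow> site list set \<Rightarrow> site list \<Rightarrow> real" where
  "total_conductance lam T x =
     (if x = tree_root then 0 else edge_conductance lam x) + (\<Sum>y\<in>children T x. edge_conductance lam y)"

definition effective_conductance :: "real \<Rightarrow> site list set \<Rightarrow> real" where
  "effective_conductance lam T =
     total_conductance lam T tree_root * measure (rw_law lam T) {\<omega>. \<forall>n\<ge>1. \<omega> n \<noteq> tree_root}"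

section \<open>Consistency of the definitions\<close>

lemma singleton_in_sets_PiM:
  assumes "finite J"
  shows "{restrict z J} \<in> sets (PiM J (\<lambda>_. count_space UNIV))"
proof -
  have "{restrict z J} = PiE J (\<lambda>i. {restrict z J i})"
    by (rule PiE_singleton[symmetric]) simp
  then show ?thesis
    using assms by (simp add: sets_PiM_I_finite del: restrict_apply)
qed

lemma prob_space_markov_law: "prob_space (markov_law K x)"
proof -
  have "space (chain.CI K x {}) = {\<lambda>_. undefined}"
    by (simp add: chain.CI_def space_PiM)
  moreover have "emeasure (markov_law K x) UNIV = emeasure (chain.CI K x {}) {\<lambda>_. undefined}"
    using chain.lim[of "{}" "{restrict (\<lambda>_. undefined) {}}" K x, OF _ singleton_in_sets_PiM]
    by (simp add: markov_law_def prod_emb_def space_PiM restrict_def vimage_def)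
  ultimately have "emeasure (markov_law K x) (space (markov_law K x)) = 1"
    using prob_space.emeasure_space_1[OF chain.PF.prob_space_P[of "{}" K x]] by simp
  then show ?thesis
    by (rule prob_spaceI)
qed

lemma emeasure_chain_C:
  "emeasure (chain.C K x 0 (Suc n) (\<lambda>_. undefined)) {restrict z {0..<Suc n}} =
     ennreal ((if z 0 = x then 1 else 0) * (\<Prod>i<n. pmf (K (z i)) (z (Suc i))))"
proof -
  let ?M = "\<lambda>_ :: nat. count_space (UNIV :: 'a set)"
  have sing: "{restrict z {0..<m}} \<in> sets (PiM {0..<m} ?M)" for m
    by (simp add: singleton_in_sets_PiM)
  have eP: "emeasure (chain.eP K x m \<omega>) {restrict z {0..<Suc m}} =
      indicator {restrict z {0..<m}} \<omega> * emeasure (path_kernel K x m (restrict z {0..<m})) {z m}"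
    if w: "\<omega> \<in> space (PiM {0..<m} ?M)" for m \<omega>
  proof -
    have ext: "\<omega> i = undefined" if "\<not> i < m" for i
      using w that by (auto simp: space_PiM PiE_def extensional_def)
    have "(\<lambda>v. fun_upd \<omega> m v) -` {restrict z {0..<Suc m}} \<inter> space (count_space UNIV) =
          (if \<omega> = restrict z {0..<m} then {z m} else {})"
    proof -
      have "fun_upd \<omega> m v = restrict z {0..<Suc m} \<longleftrightarrow> \<omega> = restrict z {0..<m} \<and> v = z m" for v
      proof
        assume eq: "fun_upd \<omega> m v = restrict z {0..<Suc m}"
        have "\<omega> i = restrict z {0..<m} i" for i
          using fun_cong[OF eq, of i] ext[of i] by (cases "i < m") auto
        moreover have "v = z m"
          using fun_cong[OF eq, of m] by simp
        ultimately show "\<omega> = restrict z {0..<m} \<and> v = z m"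
          by auto
      qed (auto simp: fun_eq_iff)
      then show ?thesis
        by auto
    qed
    then show ?thesis
      by (subst chain.emeasure_eP[OF w sing]) auto
  qed
  have step: "emeasure (chain.C K x 0 (Suc m) (\<lambda>_. undefined)) {restrict z {0..<Suc m}} =
      emeasure (path_kernel K x m (restrict z {0..<m})) {z m} *
      emeasure (chain.C K x 0 m (\<lambda>_. undefined)) {restrict z {0..<m}}" for m
  proof -
    have u: "(\<lambda>_. undefined) \<in> space (PiM {0..<0} ?M)"
      by (simp add: space_PiM)
    have "emeasure (chain.C K x 0 (Suc m) (\<lambda>_. undefined)) {restrict z {0..<Suc m}} =
       (\<integral>\<^sup>+\<omega>. emeasure (chain.eP K x m \<omega>) {restrict z {0..<Suc m}} \<partial>chain.C K x 0 m (\<lambda>_. undefined))"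
      using chain.space_C[OF u, of K x m] chain.sets_C[OF u, of K x m] chain.measurable_eP[of K x m] sing[of "Suc m"]
      by (simp add: emeasure_bind[where N = "PiM {0..<Suc m} ?M"] space_PiM PiE_eq_empty_iff
            measurable_cong_sets[OF chain.sets_C[OF u, of K x m] refl, simplified])
    also have "\<dots> = (\<integral>\<^sup>+\<omega>. emeasure (path_kernel K x m (restrict z {0..<m})) {z m} *
        indicator {restrict z {0..<m}} \<omega> \<partial>chain.C K x 0 m (\<lambda>_. undefined))"
      using chain.space_C[OF u, of K x m] by (intro nn_integral_cong) (simp add: eP mult.commute)
    also have "\<dots> = emeasure (path_kernel K x m (restrict z {0..<m})) {z m} *
        emeasure (chain.C K x 0 m (\<lambda>_. undefined)) {restrict z {0..<m}}"
      using chain.sets_C[OF u, of K x m] sing[of m] by (subst nn_integral_cmult_indicator) auto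
    finally show ?thesis .
  qed
  show ?thesis
  proof (induction n)
    case 0
    show ?case
      by (subst step)
        (auto simp: path_kernel_def restrict_def measure_pmf_single emeasure_pmf_single emeasure_return[OF sing[of 0, simplified restrict_def, simplified]] space_PiM PiM_empty indicator_def)
  next
    case (Suc n)
    show ?case
      by (subst step, subst Suc)
        (simp add: path_kernel_def emeasure_pmf_single ennreal_mult'' [symmetric] prod_nonneg mult_ac)
  qed
qed

lemma measure_markov_law_cylinder:
  "measure (markov_law K x) {\<omega>. \<forall>i\<le>n. \<omega> i = z i} =
     (if z 0 = x then 1 else 0) * (\<Prod>i<n. pmf (K (z i)) (z (Suc i)))"
proof -
  let ?M = "\<lambda>_ :: nat. count_space (UNIV :: 'a set)"
  let ?J = "{0..<Suc n}"
  have sing: "{restrict z ?J} \<in> sets (PiM ?J ?M)"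
    by (simp add: singleton_in_sets_PiM)
  have "{\<omega>. \<forall>i\<le>n. \<omega> i = z i} = prod_emb UNIV ?M ?J {restrict z ?J}"
    by (auto simp: prod_emb_def space_PiM fun_eq_iff restrict_def less_Suc_eq_le) metis+
  moreover have "prod_emb ?J ?M ?J {restrict z ?J} = {restrict z ?J}"
    using sets.sets_into_space[OF sing] by (intro prod_emb_id) (simp add: space_PiM)
  ultimately have "emeasure (markov_law K x) {\<omega>. \<forall>i\<le>n. \<omega> i = z i} =
      ennreal ((if z 0 = x then 1 else 0) * (\<Prod>i<n. pmf (K (z i)) (z (Suc i))))"
    using chain.lim[OF _ sing, of K x] chain.emeasure_CI[OF order_refl sing, of K x] emeasure_chain_C[of K x n z]
    by (simp add: markov_law_def del: chain.C.simps)
  then show ?thesis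
    by (simp add: measure_def prod_nonneg)
qed

lemma finite_children: "finite (children (saw_tree G) w)"
proof -
  obtain a b where ab: "last w = (a, b)"
    by fastforce
  have "children (saw_tree G) w \<subseteq>
      (\<lambda>p. w @ [p]) ` ({(0, 0)} \<union> {a - 1..a + 1} \<times> {b - 1..b + 1})"
  proof
    fix w' assume "w' \<in> children (saw_tree G) w"
    then obtain p where p: "w' = w @ [p]" "w @ [p] \<in> saw_tree G"
      by (auto simp: children_def)
    show "w' \<in> (\<lambda>p. w @ [p]) ` ({(0, 0)} \<union> {a - 1..a + 1} \<times> {b - 1..b + 1})"
    proof (cases "w = []")
      case True
      with p show ?thesis by (auto simp: saw_tree_def)
    next
      case False
      with p have "lattice_adj (a, b) p"
        by (auto simp: saw_tree_def successively_append_iff ab)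
      then have "p \<in> {a - 1..a + 1} \<times> {b - 1..b + 1}"
        by (cases p) (auto simp: lattice_adj_def)
      with p show ?thesis by auto
    qed
  qed
  then show ?thesis
    by (rule finite_subset) auto
qed

lemma parent_not_child: "parent x \<notin> children T x"
proof
  assume "parent x \<in> children T x"
  then obtain p where "butlast x = x @ [p]"
    by (auto simp: children_def parent_def)
  then have "length (butlast x) = length (x @ [p])"
    by (rule arg_cong)
  then show False
    by simp
qed

lemma pmf_rw_step:
  assumes "lam > 0" "x \<in> saw_tree G" "x \<noteq> tree_root"
  shows "pmf (rw_step lam (saw_tree G) x) y =
           (let k = real (card (children (saw_tree G) x)) in
            if y = parent x then 1 / (1 + k * lam)
            else if y \<in> children (saw_tree G) x then lam / (1 + k * lam) else 0)"
proof -
  define C where "C = children (saw_tree G) x"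
  define k where "k = real (card C)"
  let ?f = "\<lambda>y. if y = parent x then 1 / (1 + k * lam) else if y \<in> C then lam / (1 + k * lam) else 0"
  have fin: "finite C"
    by (simp add: C_def finite_children)
  have nin: "parent x \<notin> C"
    by (simp add: C_def parent_not_child)
  have pos: "1 + k * lam > 0"
    using assms by (simp add: k_def add_pos_nonneg)
  have nonneg: "0 \<le> ?f y" for y
    using pos assms by simp
  have "(\<integral>\<^sup>+y. ennreal (?f y) \<partial>count_space UNIV) = (\<Sum>y\<in>insert (parent x) C. ennreal (?f y))"
    using fin by (intro nn_integral_count_space'[where A = "insert (parent x) C"]) auto
  also have "\<dots> = ennreal (\<Sum>y\<in>insert (parent x) C. ?f y)"
    by (intro sum_ennreal nonneg)
  also have "(\<Sum>y\<in>insert (parent x) C. ?f y) = 1 / (1 + k * lam) + (\<Sum>y\<in>C. lam / (1 + k * lam))"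
  proof -
    have "(\<Sum>y\<in>C. ?f y) = (\<Sum>y\<in>C. lam / (1 + k * lam))"
      using nin by (intro sum.cong) auto
    then show ?thesis
      using fin nin by simp
  qed
  also have "\<dots> = 1"
    using pos by (simp add: k_def[symmetric] field_simps)
  finally have "pmf (embed_pmf ?f) y = ?f y"
    using nonneg by (intro pmf_embed_pmf) auto
  then show ?thesis
    using assms(3) by (simp only: rw_step_def C_def k_def Let_def if_False)
qed

lemma total_conductance_root: "total_conductance lam T tree_root = card (children T tree_root)"
proof -
  have "edge_conductance lam y = 1" if "y \<in> children T tree_root" for y
    using that by (auto simp: children_def edge_conductance_def parent_def depth_def tree_root_def)
  then show ?thesis
    by (simp add: total_conductance_def)
qed

text \<open>\<open>rw_step\<close> is the random walk of the network.\<close>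

lemma rw_step_network:
  assumes "lam > 0" "x \<in> saw_tree G"
  shows "x \<noteq> tree_root \<Longrightarrow>
           pmf (rw_step lam (saw_tree G) x) (parent x) =
           edge_conductance lam x / total_conductance lam (saw_tree G) x"
    and "y \<in> children (saw_tree G) x \<Longrightarrow>
           pmf (rw_step lam (saw_tree G) x) y =
           edge_conductance lam y / total_conductance lam (saw_tree G) x"
proof -
  define C where "C = children (saw_tree G) x"
  have ch: "edge_conductance lam y = lam ^ depth x" if "y \<in> C" for y
    using that by (auto simp: C_def children_def edge_conductance_def parent_def)
  have par: "lam ^ depth x = lam * edge_conductance lam x" if "x \<noteq> tree_root"
  proof -
    have "length x \<ge> 2"
      using that assms(2) by (cases x; cases "tl x") (auto simp: saw_tree_def tree_root_def)
    then have "depth x = Suc (depth (parent x))"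
      by (simp add: depth_def parent_def)
    then show ?thesis
      by (simp add: edge_conductance_def)
  qed
  have tot: "total_conductance lam (saw_tree G) x = edge_conductance lam x * (1 + card C * lam)"
    if "x \<noteq> tree_root"
    using that par[OF that] ch by (simp add: total_conductance_def C_def[symmetric] algebra_simps)
  have e: "edge_conductance lam x > 0"
    using assms by (simp add: edge_conductance_def)
  show "pmf (rw_step lam (saw_tree G) x) (parent x) =
      edge_conductance lam x / total_conductance lam (saw_tree G) x" if "x \<noteq> tree_root"
    using e by (simp add: pmf_rw_step[OF assms that] tot[OF that] C_def)
  show "pmf (rw_step lam (saw_tree G) x) y =
      edge_conductance lam y / total_conductance lam (saw_tree G) x"
    if y: "y \<in> children (saw_tree G) x"
  proof (cases "x = tree_root")
    case False
    have "y \<noteq> parent x"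
      using y parent_not_child by metis
    then show ?thesis
      using e y ch[of y] par[OF False] by (simp add: pmf_rw_step[OF assms False] tot[OF False] C_def)
  next
    case True
    have "edge_conductance lam y = 1"
      using ch[of y] y True by (simp add: C_def depth_def tree_root_def)
    moreover have "children (saw_tree G) tree_root \<noteq> {}"
      using y True by auto
    ultimately show ?thesis
      using True y by (simp add: rw_step_def finite_children total_conductance_root)
  qed
qed

end

theory Submission
  imports Defs
begin

text \<open>Let \<open>s(w)\<close> be the probability that the walk started at \<open>w\<close> never visits the parent of \<open>w\<close>. It is
  the largest solution with values in \<open>[0, 1]\<close> of
  \<open>s(w) = u / (1 + u)\<close> with \<open>u = \<lambda> \<Sum>s(y)\<close> over the children \<open>y\<close> of \<open>w\<close>, and the effective conductance
  is the sum of \<open>s\<close> over the children of the root.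

  One-sided limits in \<open>\<lambda>\<close> of \<open>s\<close> solve the same recursion. Below a walk that ends at a new record
  distance from the origin, the tree contains a copy of the quadrant tree; hence above the critical
  value all these solutions are bounded below on the record walks, and such a solution is unique, which
  gives continuity.

  The common critical value is the radius of convergence of the generating function of all
  self-avoiding walks of the plane. Below it, \<open>s\<close> at the root is at most \<open>c\<^sub>n \<lambda>\<^sup>n\<close>, which tends
  to \<open>0\<close>. Above it, the generating function of bridges diverges by the Hammersley--Welsh inequality,
  so for some \<open>n\<close> there are more than \<open>\<lambda>\<close> to the power \<open>-n\<close> bridges of length \<open>n\<close> ending at a
  nonnegative ordinate; started high enough these can be concatenated freely inside the quadrant, and
  they form a transient subtree.\<close>

section \<open>Avoiding a state\<close>

text \<open>The probability that the chain started at \<open>x\<close> avoids \<open>r\<close> at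
  the times 1 to \<open>n\<close>. Time 0 is not tested, so that \<open>x = r\<close> gives the
  probability of no return.\<close>

primrec avoid_prob :: "('s \<Rightarrow> 's pmf) \<Rightarrow> 's \<Rightarrow> nat \<Rightarrow> 's \<Rightarrow> ennreal" where
  "avoid_prob K r 0 x = 1"
| "avoid_prob K r (Suc n) x = (\<integral>\<^sup>+y. indicator (- {r}) y * avoid_prob K r n y \<partial>measure_pmf (K x))"

lemma measurable_markov_coordinate [measurable]:
  "(\<lambda>\<omega>. \<omega> i) \<in> measurable (markov_law K x) (count_space UNIV)"
proof -
  have "(\<lambda>\<omega>. \<omega> i) \<in> measurable (PiM UNIV (\<lambda>_. count_space UNIV)) (count_space UNIV)"
    by (rule measurable_component_singleton) simp
  then show ?thesis
    by (simp add: measurable_cong_sets[OF sets_markov_law refl])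
qed

lemma sets_markov_cylinder:
  fixes z :: "nat \<Rightarrow> 's :: countable"
  shows "{\<omega>. (\<forall>i\<le>m. \<omega> i = z i) \<and> (\<forall>i. P i \<longrightarrow> \<omega> i \<noteq> r)} \<in> sets (markov_law K x)"
proof -
  have "{\<omega> \<in> space (markov_law K x). (\<forall>i\<le>m. \<omega> i = z i) \<and> (\<forall>i. P i \<longrightarrow> \<omega> i \<noteq> r)} \<in> sets (markov_law K x)"
    by measurable
  then show ?thesis by simp
qed

lemma emeasure_markov_cylinder_Suc:
  "emeasure (markov_law K x) {\<omega>. \<forall>i\<le>Suc m. \<omega> i = z i} =
   emeasure (markov_law K x) {\<omega>. \<forall>i\<le>m. \<omega> i = z i} * ennreal (pmf (K (z m)) (z (Suc m)))"
proof -
  interpret prob_space "markov_law K x" by (rule prob_space_markov_law)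
  show ?thesis
    by (simp add: emeasure_eq_measure measure_markov_law_cylinder ennreal_mult'[symmetric] prod_nonneg
        mult.assoc)
qed

text \<open>The Markov property at time \<open>m\<close>. The prefix \<open>z\<close> stays general
  because the induction moves the first free step into it.\<close>

lemma emeasure_markov_avoid_after:
  fixes z :: "nat \<Rightarrow> 's :: countable"
  shows "emeasure (markov_law K x) {\<omega>. (\<forall>i\<le>m. \<omega> i = z i) \<and> (\<forall>i. m < i \<and> i \<le> m + n \<longrightarrow> \<omega> i \<noteq> r)} =
   emeasure (markov_law K x) {\<omega>. \<forall>i\<le>m. \<omega> i = z i} * avoid_prob K r n (z m)"
proof (induction n arbitrary: m z)
  case 0
  have "\<not> (m < i \<and> i \<le> m + 0)" for i by simp
  then show ?case by (simp only: simp_thms avoid_prob.simps mult_1_right)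
next
  case (Suc n)
  define X where "X y = {\<omega>. (\<forall>i\<le>Suc m. \<omega> i = (z(Suc m := y)) i) \<and>
      (\<forall>i. Suc m < i \<and> i \<le> Suc m + n \<longrightarrow> \<omega> i \<noteq> r)}" for y
  let ?c = "emeasure (markov_law K x) {\<omega>. \<forall>i\<le>m. \<omega> i = z i}"
  have X: "emeasure (markov_law K x) (X y) = ?c * (ennreal (pmf (K (z m)) y) * avoid_prob K r n y)" for y
  proof -
    have "emeasure (markov_law K x) (X y) =
      emeasure (markov_law K x) {\<omega>. \<forall>i\<le>Suc m. \<omega> i = (z(Suc m := y)) i} * avoid_prob K r n y"
      using Suc.IH[of "Suc m" "z(Suc m := y)"] by (simp add: X_def)
    also have "emeasure (markov_law K x) {\<omega>. \<forall>i\<le>Suc m. \<omega> i = (z(Suc m := y)) i} =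
       emeasure (markov_law K x) {\<omega>. \<forall>i\<le>m. \<omega> i = (z(Suc m := y)) i} * ennreal (pmf (K (z m)) y)"
      by (subst emeasure_markov_cylinder_Suc) simp
    also have "{\<omega>. \<forall>i\<le>m. \<omega> i = (z(Suc m := y)) i} = {\<omega>. \<forall>i\<le>m. \<omega> i = z i}"
      by auto
    finally show ?thesis by (simp add: mult.assoc)
  qed
  \<comment> \<open>Split according to the state \<open>y\<close> at time \<open>m + 1\<close>; the
    state space is countable.\<close>
  have "{\<omega>. (\<forall>i\<le>m. \<omega> i = z i) \<and> (\<forall>i. m < i \<and> i \<le> m + Suc n \<longrightarrow> \<omega> i \<noteq> r)} = (\<Union>y\<in>-{r}. X y)"
  proof (intro set_eqI iffI)
    fix \<omega> assume "\<omega> \<in> {\<omega>. (\<forall>i\<le>m. \<omega> i = z i) \<and> (\<forall>i. m < i \<and> i \<le> m + Suc n \<longrightarrow> \<omega> i \<noteq> r)}"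
    then have "\<omega> \<in> X (\<omega> (Suc m))" "\<omega> (Suc m) \<noteq> r"
      by (auto simp: X_def le_Suc_eq)
    then show "\<omega> \<in> (\<Union>y\<in>-{r}. X y)" by auto
  next
    fix \<omega> assume "\<omega> \<in> (\<Union>y\<in>-{r}. X y)"
    then obtain y where y: "y \<noteq> r" "\<omega> \<in> X y" by auto
    have "\<omega> i \<noteq> r" if "m < i" "i \<le> m + Suc n" for i
      using y that by (cases "i = Suc m") (auto simp: X_def)
    moreover have "\<omega> i = z i" if "i \<le> m" for i
      using y that by (auto simp: X_def split: if_splits dest!: spec[of _ i])
    ultimately show "\<omega> \<in> {\<omega>. (\<forall>i\<le>m. \<omega> i = z i) \<and> (\<forall>i. m < i \<and> i \<le> m + Suc n \<longrightarrow> \<omega> i \<noteq> r)}"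
      by auto
  qed
  also have "emeasure (markov_law K x) \<dots> = (\<integral>\<^sup>+y. emeasure (markov_law K x) (X y) \<partial>count_space (-{r}))"
  proof (rule emeasure_UN_countable)
    show "X y \<in> sets (markov_law K x)" for y
      unfolding X_def by (rule sets_markov_cylinder)
    show "disjoint_family_on X (- {r})"
      by (auto simp: disjoint_family_on_def X_def fun_upd_def dest!: spec[of _ "Suc m"])
  qed auto
  also have "\<dots> = (\<integral>\<^sup>+y. ?c * (ennreal (pmf (K (z m)) y) * (indicator (-{r}) y * avoid_prob K r n y)) \<partial>count_space UNIV)"
    by (subst nn_integral_count_space_indicator)
      (auto intro!: nn_integral_cong simp: X indicator_def)
  also have "\<dots> = ?c * avoid_prob K r (Suc n) (z m)"
    by (simp add: nn_integral_cmult nn_integral_measure_pmf)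
  finally show ?case .
qed

lemma sets_markov_never: "{\<omega>. \<forall>n\<ge>1. \<omega> n \<noteq> r} \<in> sets (markov_law K x)"
proof -
  have "{\<omega> \<in> space (markov_law K x). \<forall>n\<ge>1. \<omega> n \<noteq> r} \<in> sets (markov_law K x)"
    by measurable
  then show ?thesis by simp
qed

lemma emeasure_markov_never:
  fixes x :: "'s :: countable"
  shows "(\<lambda>n. avoid_prob K r n x) \<longlonglongrightarrow> emeasure (markov_law K x) {\<omega>. \<forall>n\<ge>1. \<omega> n \<noteq> r}"
proof -
  interpret prob_space "markov_law K x" by (rule prob_space_markov_law)
  define E where "E n = {\<omega> :: nat \<Rightarrow> 's. (\<forall>i\<le>0. \<omega> i = x) \<and> (\<forall>i. 0 < i \<and> i \<le> 0 + n \<longrightarrow> \<omega> i \<noteq> r)}" for n :: nat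
  have start: "emeasure (markov_law K x) {\<omega>. \<forall>i\<le>0. \<omega> i = x} = 1"
    using measure_markov_law_cylinder[of K x 0 "\<lambda>_. x"] by (simp add: emeasure_eq_measure)
  have E: "emeasure (markov_law K x) (E n) = avoid_prob K r n x" for n
    using emeasure_markov_avoid_after[of K x 0 "\<lambda>_. x" n r] start by (simp add: E_def)
  have "(\<lambda>n. emeasure (markov_law K x) (E n)) \<longlonglongrightarrow> emeasure (markov_law K x) (\<Inter>n. E n)"
  proof (rule Lim_emeasure_decseq)
    show "range E \<subseteq> events"
      using sets_markov_cylinder[of 0 "\<lambda>_. x"] by (auto simp: E_def)
    show "decseq E"
      by (force simp: E_def decseq_def)
  qed simp
  \<comment> \<open>The events \<open>E n\<close> also prescribe the start \<open>x\<close>, which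
    the law guarantees only almost surely.\<close>
  also have "emeasure (markov_law K x) (\<Inter>n. E n) = emeasure (markov_law K x) {\<omega>. \<forall>n\<ge>1. \<omega> n \<noteq> r}"
  proof (rule emeasure_eq_AE)
    have "AE \<omega> in markov_law K x. \<omega> 0 = x"
      using start prob_eq_1[of "{\<omega>. \<omega> 0 = x}"] sets_markov_cylinder[of 0 "\<lambda>_. x" "\<lambda>_. False" x K x]
      by (simp add: emeasure_eq_measure)
    then show "AE \<omega> in markov_law K x. (\<omega> \<in> (\<Inter>n. E n)) = (\<omega> \<in> {\<omega>. \<forall>n\<ge>1. \<omega> n \<noteq> r})"
      by eventually_elim (auto simp: E_def Suc_le_eq)
    show "(\<Inter>n. E n) \<in> events"
      using sets_markov_cylinder[of 0 "\<lambda>_. x"] by (auto simp: E_def)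
  qed (rule sets_markov_never)
  finally show ?thesis by (simp add: E)
qed

section \<open>The escape recursion\<close>

text \<open>The conductance of a unit conductor in series with a conductance
  \<open>u\<close>.\<close>

definition series_step :: "real \<Rightarrow> real" where
  "series_step u = u / (1 + u)"

lemma series_step_bounds: "0 \<le> u \<Longrightarrow> 0 \<le> series_step u" "0 \<le> u \<Longrightarrow> series_step u \<le> 1"
  "0 \<le> u \<Longrightarrow> series_step u \<le> u"
  by (auto simp: series_step_def field_simps)

lemma series_step_mono: "0 \<le> u \<Longrightarrow> u \<le> v \<Longrightarrow> series_step u \<le> series_step v"
  by (auto simp: series_step_def field_simps)

lemma series_step_pos: "0 < u \<Longrightarrow> 0 < series_step u"
  by (simp add: series_step_def)

lemma one_minus_series_step: "0 \<le> u \<Longrightarrow> (1 - series_step u) * (1 + u) = 1"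
  by (simp add: series_step_def field_simps)

lemma tendsto_series_step:
  assumes "(f \<longlongrightarrow> u) F" "0 \<le> u"
  shows "((\<lambda>x. series_step (f x)) \<longlongrightarrow> series_step u) F"
  unfolding series_step_def using assms by (intro tendsto_intros) auto

text \<open>This is concavity of \<open>series_step\<close> together with its value 0 at 0.\<close>

lemma series_step_scale_ge:
  assumes "0 \<le> u" "0 \<le> k" "k \<le> 1"
  shows "k * series_step u \<le> series_step (k * u)"
proof -
  have "k * u \<le> u"
    using assms by (simp add: mult_left_le_one_le)
  then have "k * u / (1 + u) \<le> k * u / (1 + k * u)"
    using assms by (intro divide_left_mono) (auto intro!: mult_pos_pos add_pos_nonneg)
  then show ?thesis
    by (simp add: series_step_def)
qed

text \<open>The quotient \<open>(1 + u) / (1 + k * u)\<close> increases with \<open>u\<close>, and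
  \<open>a\<close> is at most \<open>u\<close>. For \<open>0 < k < 1\<close> and
  \<open>0 < a\<close> the factor is larger than \<open>k\<close>; this strict gain is what makes
  solutions of the recursion unique.\<close>

lemma series_step_scale_gain:
  assumes "a \<le> series_step u" "0 \<le> u" "0 \<le> k" "k \<le> 1" "0 \<le> a"
  shows "k * (1 + a) / (1 + k * a) * series_step u \<le> series_step (k * u)"
proof -
  have "a \<le> u"
    using assms series_step_bounds(3)[of u] by linarith
  then have "0 \<le> (1 - k) * (u - a)"
    using assms by (intro mult_nonneg_nonneg) auto
  then have "(1 + a) * (1 + k * u) \<le> (1 + u) * (1 + k * a)"
    by (simp add: algebra_simps)
  moreover have "0 < 1 + k * a" "0 < 1 + k * u"
    using assms by (auto intro: add_pos_nonneg)
  ultimately have "(1 + a) / (1 + k * a) \<le> (1 + u) / (1 + k * u)"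
    by (simp add: divide_simps)
  then have "(1 + a) / (1 + k * a) * (k * series_step u) \<le> (1 + u) / (1 + k * u) * (k * series_step u)"
    using assms by (intro mult_right_mono) (auto simp: series_step_bounds)
  also have "\<dots> = series_step (k * u)"
    using assms by (simp add: series_step_def)
  finally show ?thesis
    by (simp add: mult_ac)
qed

section \<open>The recursion on the tree and its greatest solution\<close>

abbreviation kids :: "site set \<Rightarrow> site list \<Rightarrow> site list set" where
  "kids G w \<equiv> children (saw_tree G) w"

text \<open>The probability that the walk started at \<open>w\<close> gets \<open>n\<close>
  generations below \<open>w\<close> before it visits the parent of \<open>w\<close>. The root is
  treated like any other vertex, as if it had a parent too.\<close>

primrec escape_upto :: "nat \<Rightarrow> real \<Rightarrow> site set \<Rightarrow> site list \<Rightarrow> real" where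
  "escape_upto 0 lam G w = 1"
| "escape_upto (Suc n) lam G w = series_step (lam * (\<Sum>y\<in>kids G w. escape_upto n lam G y))"

definition escape :: "real \<Rightarrow> site set \<Rightarrow> site list \<Rightarrow> real" where
  "escape lam G w = lim (\<lambda>n. escape_upto n lam G w)"

lemma escape_upto_nonneg: "0 \<le> lam \<Longrightarrow> 0 \<le> escape_upto n lam G w"
  by (induction n arbitrary: w) (auto intro!: series_step_bounds mult_nonneg_nonneg sum_nonneg)

lemma escape_upto_le_1: "0 \<le> lam \<Longrightarrow> escape_upto n lam G w \<le> 1"
  by (cases n) (auto intro!: series_step_bounds mult_nonneg_nonneg sum_nonneg escape_upto_nonneg)

lemma escape_upto_Suc_le: "0 \<le> lam \<Longrightarrow> escape_upto (Suc n) lam G w \<le> escape_upto n lam G w"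
proof (induction n arbitrary: w)
  case 0
  then show ?case using escape_upto_le_1[of lam "Suc 0"] by simp
next
  case (Suc n)
  show ?case
    unfolding escape_upto.simps(2)[of "Suc n"] escape_upto.simps(2)[of n lam G w] using Suc
    by (intro series_step_mono mult_nonneg_nonneg sum_nonneg mult_left_mono sum_mono escape_upto_nonneg)
qed

lemma escape_upto_LIMSEQ:
  assumes "0 \<le> lam"
  shows "(\<lambda>n. escape_upto n lam G w) \<longlonglongrightarrow> escape lam G w"
proof -
  have "decseq (\<lambda>n. escape_upto n lam G w)"
    using escape_upto_Suc_le[OF assms] by (rule decseq_SucI)
  then have "convergent (\<lambda>n. escape_upto n lam G w)"
    using escape_upto_nonneg[OF assms] by (metis decseq_convergent convergent_def)
  then show ?thesis
    by (simp add: escape_def convergent_LIMSEQ_iff)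
qed

lemma escape_le_upto: "0 \<le> lam \<Longrightarrow> escape lam G w \<le> escape_upto n lam G w"
  using decseq_ge[OF decseq_SucI escape_upto_LIMSEQ] escape_upto_Suc_le by blast

lemma escape_nonneg: "0 \<le> lam \<Longrightarrow> 0 \<le> escape lam G w"
  by (rule LIMSEQ_le_const[OF escape_upto_LIMSEQ]) (auto intro: escape_upto_nonneg)

lemma escape_le_1: "0 \<le> lam \<Longrightarrow> escape lam G w \<le> 1"
  using escape_le_upto[of lam G w 0] by simp

lemma escape_rec:
  assumes "0 \<le> lam"
  shows "escape lam G w = series_step (lam * (\<Sum>y\<in>kids G w. escape lam G y))"
proof (rule LIMSEQ_unique)
  show "(\<lambda>n. escape_upto (Suc n) lam G w) \<longlonglongrightarrow> escape lam G w"
    using escape_upto_LIMSEQ[OF assms] by (rule LIMSEQ_Suc)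
  show "(\<lambda>n. escape_upto (Suc n) lam G w) \<longlonglongrightarrow> series_step (lam * (\<Sum>y\<in>kids G w. escape lam G y))"
    unfolding escape_upto.simps using assms
    by (intro tendsto_series_step tendsto_intros escape_upto_LIMSEQ mult_nonneg_nonneg sum_nonneg escape_nonneg)
qed

text \<open>A subsolution lies below the constant 1, and the monotone recursion keeps it below every
  iterate that starts from there.\<close>

lemma escape_greatest:
  assumes "0 \<le> lam" "\<And>w. 0 \<le> t w" "\<And>w. t w \<le> 1"
    and "\<And>w. t w \<le> series_step (lam * (\<Sum>y\<in>kids G w. t y))"
  shows "t w \<le> escape lam G w"
proof (rule LIMSEQ_le_const[OF escape_upto_LIMSEQ[OF assms(1)]], intro exI allI impI)
  fix n
  show "t w \<le> escape_upto n lam G w"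
  proof (induction n arbitrary: w)
    case (Suc n)
    have "t w \<le> series_step (lam * (\<Sum>y\<in>kids G w. t y))" by (rule assms)
    also have "\<dots> \<le> escape_upto (Suc n) lam G w"
      unfolding escape_upto.simps
      by (intro series_step_mono mult_left_mono sum_mono Suc assms mult_nonneg_nonneg sum_nonneg)
    finally show ?case .
  qed (use assms in auto)
qed

lemma escape_upto_mono:
  assumes "0 \<le> lam" "lam \<le> lam'"
  shows "escape_upto n lam G w \<le> escape_upto n lam' G w"
proof (induction n arbitrary: w)
  case (Suc n)
  show ?case
    unfolding escape_upto.simps using assms
    by (intro series_step_mono mult_mono sum_mono Suc mult_nonneg_nonneg sum_nonneg escape_upto_nonneg) auto
qed simp

lemma escape_mono: "0 \<le> lam \<Longrightarrow> lam \<le> lam' \<Longrightarrow> escape lam G w \<le> escape lam' G w"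
  by (rule LIMSEQ_le[OF escape_upto_LIMSEQ escape_upto_LIMSEQ]) (auto intro: escape_upto_mono)

lemma kids_subset: "kids G w \<subseteq> saw_tree G"
  by (auto simp: children_def)

text \<open>Rayleigh monotonicity: the image of the first tree is a subtree of the second, and
  further branches only add nonnegative terms to the sums over children.\<close>

lemma escape_embedding:
  assumes lam: "0 \<le> lam" and inj: "inj_on e (saw_tree G)"
    and kids: "\<And>v y. v \<in> saw_tree G \<Longrightarrow> y \<in> kids G v \<Longrightarrow> e y \<in> kids H (e v)"
    and v: "v \<in> saw_tree G"
  shows "escape lam G v \<le> escape lam H (e v)"
proof (rule LIMSEQ_le[OF escape_upto_LIMSEQ escape_upto_LIMSEQ], goal_cases)
  case 3
  have "escape_upto n lam G v \<le> escape_upto n lam H (e v)" for n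
    using v
  proof (induction n arbitrary: v)
    case (Suc n)
    have "(\<Sum>y\<in>kids G v. escape_upto n lam G y) \<le> (\<Sum>y\<in>kids G v. escape_upto n lam H (e y))"
      using kids_subset Suc.IH by (intro sum_mono) auto
    also have "\<dots> = (\<Sum>y\<in>e ` kids G v. escape_upto n lam H y)"
      by (subst sum.reindex[OF inj_on_subset[OF inj kids_subset]]) simp
    also have "\<dots> \<le> (\<Sum>y\<in>kids H (e v). escape_upto n lam H y)"
      using kids Suc.prems lam by (intro sum_mono2 finite_children escape_upto_nonneg) auto
    finally show ?case
      unfolding escape_upto.simps using lam
      by (intro series_step_mono mult_left_mono mult_nonneg_nonneg sum_nonneg escape_upto_nonneg)
  qed simp
  then show ?case by auto
qed (use lam in auto)

lemma escape_mono_graph: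
  assumes "0 \<le> lam" "G \<subseteq> H" "v \<in> saw_tree G"
  shows "escape lam G v \<le> escape lam H v"
  using escape_embedding[OF assms(1), of id G H v] assms
  by (auto simp: saw_tree_def children_def)

section \<open>Escape probabilities and the random walk\<close>

lemma kids_root_nonempty_card: "kids G tree_root \<noteq> {} \<Longrightarrow> 0 < card (kids G tree_root)"
  by (simp add: card_gt_0_iff finite_children)

lemma parent_in_saw_tree:
  assumes "x \<in> saw_tree G" "x \<noteq> tree_root"
  shows "parent x \<in> saw_tree G"
proof -
  obtain a b t where x: "x = a # b # t"
    using assms by (cases x; cases "tl x") (auto simp: saw_tree_def tree_root_def)
  have "x = butlast x @ [last x]"
    using x by simp
  then have "successively lattice_adj (butlast x)" "distinct (butlast x)"
    using assms(1) unfolding saw_tree_def mem_Collect_eq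
    by (metis successively_append_iff, metis distinct_append)
  moreover have "set (butlast x) \<subseteq> G"
    using assms(1) by (auto simp: saw_tree_def dest: in_set_butlastD)
  ultimately show ?thesis
    using assms(1) x by (auto simp: saw_tree_def parent_def)
qed

lemma nn_integral_rw_step:
  assumes lam: "0 < lam" and x: "x \<in> saw_tree G" "x \<noteq> tree_root"
    and f: "\<And>y. y \<in> saw_tree G \<Longrightarrow> f y = ennreal (g y)" "\<And>y. 0 \<le> g y"
  shows "(\<integral>\<^sup>+y. f y \<partial>measure_pmf (rw_step lam (saw_tree G) x)) =
    ennreal ((g (parent x) + lam * (\<Sum>y\<in>kids G x. g y)) / (1 + real (card (kids G x)) * lam))"
proof -
  define d where "d = 1 + real (card (kids G x)) * lam"
  have d: "0 < d"
    using lam by (simp add: d_def add_pos_nonneg)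
  have p: "pmf (rw_step lam (saw_tree G) x) y =
      (if y = parent x then 1 / d else if y \<in> kids G x then lam / d else 0)" for y
    by (simp add: pmf_rw_step[OF lam x] d_def)
  have supp: "y \<in> saw_tree G" if "y \<in> insert (parent x) (kids G x)" for y
    using that x by (auto dest: subsetD[OF kids_subset] intro: parent_in_saw_tree)
  have "(\<integral>\<^sup>+y. f y \<partial>measure_pmf (rw_step lam (saw_tree G) x)) =
      (\<Sum>y\<in>insert (parent x) (kids G x). f y * ennreal (pmf (rw_step lam (saw_tree G) x) y))"
    by (rule nn_integral_measure_pmf_support)
      (auto simp: finite_children set_pmf_eq p split: if_splits)
  also have "\<dots> = (\<Sum>y\<in>insert (parent x) (kids G x). ennreal (g y * pmf (rw_step lam (saw_tree G) x) y))"
    by (intro sum.cong refl) (simp add: f supp ennreal_mult)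
  also have "\<dots> = ennreal (\<Sum>y\<in>insert (parent x) (kids G x). g y * pmf (rw_step lam (saw_tree G) x) y)"
    by (intro sum_ennreal) (simp add: f)
  also have "(\<Sum>y\<in>insert (parent x) (kids G x). g y * pmf (rw_step lam (saw_tree G) x) y) =
      g (parent x) / d + (\<Sum>y\<in>kids G x. g y * (lam / d))"
    using parent_not_child[of x "saw_tree G"]
    by (subst sum.insert) (auto simp: finite_children p intro!: sum.cong)
  also have "\<dots> = (g (parent x) + lam * (\<Sum>y\<in>kids G x. g y)) / d"
    by (simp add: sum_distrib_left sum_divide_distrib add_divide_distrib mult_ac)
  finally show ?thesis
    by (simp add: d_def)
qed

text \<open>The real-valued counterpart of \<open>avoid_prob\<close> with time 0 included: the walk
  from \<open>x\<close> is off the root at the times 0 to \<open>n\<close>. The boundary value 0 at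
  the root makes the limit in \<open>n\<close> harmonic elsewhere.\<close>

primrec avoid_root :: "nat \<Rightarrow> real \<Rightarrow> site set \<Rightarrow> site list \<Rightarrow> real" where
  "avoid_root 0 lam G x = (if x = tree_root then 0 else 1)"
| "avoid_root (Suc n) lam G x = (if x = tree_root then 0 else
     (avoid_root n lam G (parent x) + lam * (\<Sum>y\<in>kids G x. avoid_root n lam G y)) / (1 + real (card (kids G x)) * lam))"

lemma avoid_root_nonneg: "0 \<le> lam \<Longrightarrow> 0 \<le> avoid_root n lam G x"
  by (induction n arbitrary: x)
    (auto intro!: divide_nonneg_nonneg add_nonneg_nonneg mult_nonneg_nonneg sum_nonneg)

lemma avoid_root_Suc_le: "0 \<le> lam \<Longrightarrow> avoid_root (Suc n) lam G x \<le> avoid_root n lam G x"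
proof (induction n arbitrary: x)
  case 0
  have "(\<Sum>y\<in>kids G x. avoid_root 0 lam G y) \<le> (\<Sum>y\<in>kids G x. 1)"
    by (intro sum_mono) simp
  then have "avoid_root 0 lam G (parent x) + lam * (\<Sum>y\<in>kids G x. avoid_root 0 lam G y) \<le> 1 + lam * real (card (kids G x))"
    using 0 by (intro add_mono mult_left_mono) auto
  moreover have "0 < 1 + real (card (kids G x)) * lam"
    using 0 by (simp add: add_pos_nonneg)
  ultimately show ?case
    by (simp add: divide_simps mult.commute del: avoid_root.simps(1)) simp
next
  case (Suc n)
  show ?case
    unfolding avoid_root.simps(2)[of "Suc n"] avoid_root.simps(2)[of n lam G x] using Suc
    by (auto intro!: divide_right_mono add_mono mult_left_mono sum_mono simp del: avoid_root.simps)
qed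

lemma avoid_prob_rw_step:
  assumes lam: "0 < lam" and x: "x \<in> saw_tree G"
  shows "indicator (- {tree_root}) x * avoid_prob (rw_step lam (saw_tree G)) tree_root n x =
    ennreal (avoid_root n lam G x)"
  using x
proof (induction n arbitrary: x)
  case (Suc n)
  show ?case
  proof (cases "x = tree_root")
    case False
    then show ?thesis
      using nn_integral_rw_step[OF lam Suc.prems False Suc.IH] lam by (simp add: avoid_root_nonneg)
  qed simp
qed auto

lemma avoid_prob_rw_step_root:
  assumes lam: "0 < lam" and ne: "kids G tree_root \<noteq> {}"
  shows "avoid_prob (rw_step lam (saw_tree G)) tree_root (Suc n) tree_root =
    ennreal ((\<Sum>y\<in>kids G tree_root. avoid_root n lam G y) / card (kids G tree_root))"
proof -
  have "avoid_prob (rw_step lam (saw_tree G)) tree_root (Suc n) tree_root =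
     (\<Sum>y\<in>kids G tree_root. indicator (- {tree_root}) y * avoid_prob (rw_step lam (saw_tree G)) tree_root n y) /
       card (kids G tree_root)"
    using ne by (simp add: rw_step_def nn_integral_pmf_of_set finite_children)
  also have "(\<Sum>y\<in>kids G tree_root. indicator (- {tree_root}) y * avoid_prob (rw_step lam (saw_tree G)) tree_root n y) =
     (\<Sum>y\<in>kids G tree_root. ennreal (avoid_root n lam G y))"
    using kids_subset by (intro sum.cong refl avoid_prob_rw_step lam) auto
  also have "\<dots> = ennreal (\<Sum>y\<in>kids G tree_root. avoid_root n lam G y)"
    using lam by (intro sum_ennreal avoid_root_nonneg) auto
  finally show ?thesis
    using kids_root_nonempty_card[OF ne] lam
    by (simp add: divide_ennreal[symmetric] sum_nonneg avoid_root_nonneg ennreal_of_nat_eq_real_of_nat)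
qed

text \<open>To return to the root the walk must cross downwards all edges on the branch of \<open>x\<close>, one
  after the other.\<close>

definition return_prob :: "real \<Rightarrow> site set \<Rightarrow> site list \<Rightarrow> real" where
  "return_prob lam G x = (\<Prod>i\<in>{2..length x}. 1 - escape lam G (take i x))"

lemma return_prob_nonneg: "0 \<le> lam \<Longrightarrow> 0 \<le> return_prob lam G x"
  by (auto simp: return_prob_def escape_le_1 intro!: prod_nonneg)

lemma return_prob_root [simp]: "return_prob lam G tree_root = 1"
  by (simp add: return_prob_def tree_root_def)

lemma return_prob_snoc:
  assumes "x \<noteq> []"
  shows "return_prob lam G (x @ [p]) = return_prob lam G x * (1 - escape lam G (x @ [p]))"
proof -
  have "{2..length (x @ [p])} = insert (length (x @ [p])) {2..length x}"
    using assms by (cases x) auto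
  then show ?thesis
    by (auto simp: return_prob_def mult.commute intro!: prod.cong)
qed

lemma return_prob_kid:
  "x \<in> saw_tree G \<Longrightarrow> y \<in> kids G x \<Longrightarrow> return_prob lam G y = return_prob lam G x * (1 - escape lam G y)"
  by (auto simp: children_def saw_tree_def return_prob_snoc)

lemma return_prob_parent:
  assumes "x \<in> saw_tree G" "x \<noteq> tree_root"
  shows "return_prob lam G x = return_prob lam G (parent x) * (1 - escape lam G x)"
proof -
  have "x = parent x @ [last x]"
    using assms by (auto simp: saw_tree_def parent_def)
  moreover have "parent x \<noteq> []"
    using parent_in_saw_tree[OF assms] by (auto simp: saw_tree_def)
  ultimately show ?thesis
    by (metis return_prob_snoc)
qed

text \<open>Let \<open>u\<close> be \<open>lam\<close> times the sum of \<open>escape\<close> over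
  the children. Since \<open>1 - escape\<close> at \<open>x\<close> is the inverse of
  \<open>1 + u\<close>, passing to the parent multiplies \<open>return_prob\<close> by
  \<open>1 + u\<close>, while the children contribute their number times \<open>lam\<close> minus
  \<open>u\<close>.\<close>

lemma return_prob_harmonic:
  assumes lam: "0 \<le> lam" and x: "x \<in> saw_tree G" "x \<noteq> tree_root"
  shows "return_prob lam G (parent x) + lam * (\<Sum>y\<in>kids G x. return_prob lam G y) =
    (1 + real (card (kids G x)) * lam) * return_prob lam G x"
proof -
  define u where "u = lam * (\<Sum>y\<in>kids G x. escape lam G y)"
  have u: "0 \<le> u"
    using lam by (auto simp: u_def intro!: mult_nonneg_nonneg sum_nonneg escape_nonneg)
  have "return_prob lam G x * (1 + u) = return_prob lam G (parent x) * ((1 - escape lam G x) * (1 + u))"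
    by (simp add: return_prob_parent[OF x])
  also have "(1 - escape lam G x) * (1 + u) = 1"
    using one_minus_series_step[OF u] by (subst escape_rec[OF lam]) (simp add: u_def)
  finally have "return_prob lam G (parent x) = return_prob lam G x * (1 + u)" by simp
  moreover have "lam * (\<Sum>y\<in>kids G x. return_prob lam G y) = return_prob lam G x * (real (card (kids G x)) * lam - u)"
  proof -
    have "(\<Sum>y\<in>kids G x. return_prob lam G y) = return_prob lam G x * (\<Sum>y\<in>kids G x. 1 - escape lam G y)"
      by (simp add: return_prob_kid[OF x(1)] sum_distrib_left)
    then show ?thesis
      by (simp add: u_def sum_subtractf right_diff_distrib mult_ac)
  qed
  ultimately show ?thesis
    by (simp add: algebra_simps)
qed

text \<open>The left side is harmonic off the root, vanishes there and is at most 1, so it stays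
  below each iterate of the harmonic recursion started from 1 off the root.\<close>

lemma avoid_root_ge:
  assumes lam: "0 \<le> lam" and x: "x \<in> saw_tree G"
  shows "1 - return_prob lam G x \<le> avoid_root n lam G x"
  using x
proof (induction n arbitrary: x)
  case 0
  then show ?case using return_prob_nonneg[OF lam] by simp
next
  case (Suc n)
  show ?case
  proof (cases "x = tree_root")
    case False
    define d where "d = 1 + real (card (kids G x)) * lam"
    have d: "0 < d"
      using lam by (simp add: d_def add_pos_nonneg)
    have "d * (1 - return_prob lam G x) = (1 - return_prob lam G (parent x)) + lam * (\<Sum>y\<in>kids G x. 1 - return_prob lam G y)"
      using return_prob_harmonic[OF lam Suc.prems False]
      by (simp add: d_def sum_subtractf algebra_simps)
    also have "\<dots> \<le> avoid_root n lam G (parent x) + lam * (\<Sum>y\<in>kids G x. avoid_root n lam G y)"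
      using parent_in_saw_tree[OF Suc.prems False] kids_subset lam
      by (intro add_mono mult_left_mono sum_mono Suc.IH) auto
    finally have "1 - return_prob lam G x \<le>
        (avoid_root n lam G (parent x) + lam * (\<Sum>y\<in>kids G x. avoid_root n lam G y)) / d"
      by (simp add: pos_le_divide_eq[OF d] mult.commute)
    then show ?thesis
      using False by (simp add: d_def)
  qed simp
qed

text \<open>The upper bound that matches \<open>avoid_root_ge\<close>. By harmonicity the increment
  into \<open>x\<close> is \<open>lam\<close> times the sum of the increments out of
  \<open>x\<close>, and these are controlled one generation further down.\<close>

lemma harmonic_increment_le:
  assumes lam: "0 \<le> lam" and q: "\<And>x. q x \<le> 1"
    and harm: "\<And>x. x \<in> saw_tree G \<Longrightarrow> x \<noteq> tree_root \<Longrightarrow>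
      (1 + real (card (kids G x)) * lam) * q x = q (parent x) + lam * (\<Sum>y\<in>kids G x. q y)"
    and x: "x \<in> saw_tree G" "x \<noteq> tree_root"
  shows "q x - q (parent x) \<le> escape_upto n lam G x * (1 - q (parent x))"
  using x
proof (induction n arbitrary: x)
  case 0
  then show ?case using q by simp
next
  case (Suc n)
  define u where "u = lam * (\<Sum>y\<in>kids G x. escape_upto n lam G y)"
  have u: "0 \<le> u"
    using lam by (auto simp: u_def intro!: mult_nonneg_nonneg sum_nonneg escape_upto_nonneg)
  have y: "q y - q x \<le> escape_upto n lam G y * (1 - q x)" if "y \<in> kids G x" for y
  proof -
    have "parent y = x" "y \<in> saw_tree G" "y \<noteq> tree_root"
      using that Suc.prems by (auto simp: children_def parent_def saw_tree_def tree_root_def)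
    then show ?thesis
      using Suc.IH[of y] by simp
  qed
  have "q x - q (parent x) = lam * (\<Sum>y\<in>kids G x. q y - q x)"
    using harm[OF Suc.prems] by (simp add: sum_subtractf algebra_simps)
  also have "\<dots> \<le> lam * (\<Sum>y\<in>kids G x. escape_upto n lam G y * (1 - q x))"
    using lam y by (intro mult_left_mono sum_mono)
  also have "\<dots> = u * (1 - q x)"
    by (simp add: u_def sum_distrib_right mult.assoc)
  \<comment> \<open>Write \<open>1 - q x\<close> as
    \<open>(1 - q (parent x)) - (q x - q (parent x))\<close> and collect the increment on the left;
    dividing by \<open>1 + u\<close> then produces \<open>series_step u\<close>.\<close>
  finally have "(q x - q (parent x)) * (1 + u) \<le> u * (1 - q (parent x))"
    by (simp add: algebra_simps)
  then show ?case
    using u by (simp add: u_def[symmetric] series_step_def field_simps)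
qed

text \<open>The two bounds meet at a child of the root: there \<open>1 - return_prob\<close> equals
  \<open>escape\<close>, and the limit \<open>q\<close> vanishes at the parent.\<close>

lemma avoid_root_kid_LIMSEQ:
  assumes lam: "0 \<le> lam" and root: "tree_root \<in> saw_tree G" and y: "y \<in> kids G tree_root"
  shows "(\<lambda>n. avoid_root n lam G y) \<longlonglongrightarrow> escape lam G y"
proof -
  define q where "q x = lim (\<lambda>n. avoid_root n lam G x)" for x
  have dec: "decseq (\<lambda>n. avoid_root n lam G x)" for x
    using avoid_root_Suc_le[OF lam] by (rule decseq_SucI)
  have q: "(\<lambda>n. avoid_root n lam G x) \<longlonglongrightarrow> q x" for x
  proof -
    have "convergent (\<lambda>n. avoid_root n lam G x)"
      using decseq_convergent[OF dec, of 0 x] avoid_root_nonneg[OF lam] by (metis convergent_def)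
    then show ?thesis
      by (simp add: q_def convergent_LIMSEQ_iff)
  qed
  have q1: "q x \<le> 1" for x
    using decseq_ge[OF dec q, of x 0] by (auto split: if_splits)
  have q0: "q tree_root = 0"
  proof -
    have "avoid_root n lam G tree_root = 0" for n
      by (cases n) auto
    then show ?thesis
      using q[of tree_root] by (simp add: LIMSEQ_const_iff)
  qed
  have harm: "(1 + real (card (kids G x)) * lam) * q x = q (parent x) + lam * (\<Sum>y\<in>kids G x. q y)"
    if x: "x \<noteq> tree_root" for x
  proof (rule LIMSEQ_unique)
    have "0 < 1 + real (card (kids G x)) * lam"
      using lam by (simp add: add_pos_nonneg)
    then have eq: "(1 + real (card (kids G x)) * lam) * avoid_root (Suc n) lam G x =
       avoid_root n lam G (parent x) + lam * (\<Sum>y\<in>kids G x. avoid_root n lam G y)" for n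
      using x by simp
    show "(\<lambda>n. (1 + real (card (kids G x)) * lam) * avoid_root (Suc n) lam G x) \<longlonglongrightarrow> (1 + real (card (kids G x)) * lam) * q x"
      by (intro tendsto_intros LIMSEQ_Suc q)
    show "(\<lambda>n. (1 + real (card (kids G x)) * lam) * avoid_root (Suc n) lam G x) \<longlonglongrightarrow> q (parent x) + lam * (\<Sum>y\<in>kids G x. q y)"
      unfolding eq by (intro tendsto_intros q)
  qed
  have y': "parent y = tree_root" "y \<in> saw_tree G" "y \<noteq> tree_root"
    using y by (auto simp: children_def parent_def saw_tree_def tree_root_def)
  have "q y \<le> escape_upto n lam G y" for n
    using harmonic_increment_le[OF lam q1 harm y'(2,3), of n] by (simp add: y' q0)
  then have "q y \<le> escape lam G y"
    by (intro LIMSEQ_le_const[OF escape_upto_LIMSEQ[OF lam]]) auto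
  moreover have "escape lam G y \<le> q y"
    using avoid_root_ge[OF lam y'(2)] return_prob_kid[OF root y]
    by (intro LIMSEQ_le_const[OF q]) auto
  ultimately show ?thesis
    using q[of y] by simp
qed

section \<open>Conductance and recurrence in terms of \<open>escape\<close>\<close>

lemma space_rw_law: "space (rw_law lam T) = UNIV"
  by (simp add: rw_law_def)

lemma rw_never_returns:
  assumes lam: "0 < lam" and root: "tree_root \<in> saw_tree G" and ne: "kids G tree_root \<noteq> {}"
  shows "measure (rw_law lam (saw_tree G)) {\<omega>. \<forall>n\<ge>1. \<omega> n \<noteq> tree_root} =
    (\<Sum>y\<in>kids G tree_root. escape lam G y) / card (kids G tree_root)" (is "_ = ?R")
proof -
  have lim: "(\<lambda>n. ennreal ((\<Sum>y\<in>kids G tree_root. avoid_root n lam G y) / card (kids G tree_root))) \<longlonglongrightarrow> ennreal ?R"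
    using kids_root_nonempty_card[OF ne] lam
    by (intro tendsto_ennrealI tendsto_divide tendsto_sum avoid_root_kid_LIMSEQ root tendsto_const) auto
  have "(\<lambda>n. ennreal ((\<Sum>y\<in>kids G tree_root. avoid_root n lam G y) / card (kids G tree_root)))
      \<longlonglongrightarrow> emeasure (rw_law lam (saw_tree G)) {\<omega>. \<forall>n\<ge>1. \<omega> n \<noteq> tree_root}"
    using LIMSEQ_Suc[OF emeasure_markov_never[where K = "rw_step lam (saw_tree G)" and x = tree_root and r = tree_root]]
    unfolding rw_law_def avoid_prob_rw_step_root[OF lam ne] .
  from LIMSEQ_unique[OF this lim]
  have "emeasure (rw_law lam (saw_tree G)) {\<omega>. \<forall>n\<ge>1. \<omega> n \<noteq> tree_root} = ennreal ?R" .
  then show ?thesis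
    using lam by (simp add: measure_def sum_nonneg escape_nonneg)
qed

text \<open>The total conductance at the root is the number of its children and cancels the uniform
  choice of the first step.\<close>

lemma effective_conductance_eq:
  assumes "0 < lam" "tree_root \<in> saw_tree G" "kids G tree_root \<noteq> {}"
  shows "effective_conductance lam (saw_tree G) = (\<Sum>y\<in>kids G tree_root. escape lam G y)"
  using kids_root_nonempty_card[OF assms(3)]
  by (simp add: effective_conductance_def total_conductance_root rw_never_returns[OF assms] del: One_nat_def)

text \<open>At the root \<open>escape\<close> is \<open>series_step\<close> of a positive multiple
  of the sum over the children, so it vanishes exactly when the probability of no return
  does.\<close>

lemma recurrent_iff:
  assumes lam: "0 < lam" and root: "tree_root \<in> saw_tree G" and ne: "kids G tree_root \<noteq> {}"
  shows "recurrent lam (saw_tree G) \<longleftrightarrow> escape lam G tree_root = 0"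
proof -
  let ?M = "rw_law lam (saw_tree G)" and ?N = "{\<omega>. \<forall>n\<ge>1. \<omega> n \<noteq> tree_root}"
  let ?S = "\<Sum>y\<in>kids G tree_root. escape lam G y"
  interpret prob_space ?M
    unfolding rw_law_def by (rule prob_space_markov_law)
  have N: "?N \<in> events"
    unfolding rw_law_def by (rule sets_markov_never)
  have "recurrent lam (saw_tree G) \<longleftrightarrow> (AE \<omega> in ?M. \<omega> \<notin> ?N)"
    by (simp add: recurrent_def)
  also have "\<dots> \<longleftrightarrow> measure ?M ?N = 0"
    using AE_iff_measurable[OF N, of "\<lambda>\<omega>. \<omega> \<notin> ?N"]
    by (simp add: emeasure_eq_measure space_rw_law del: One_nat_def)
  also have "\<dots> \<longleftrightarrow> ?S = 0"
    using kids_root_nonempty_card[OF ne] by (simp add: rw_never_returns[OF assms] del: One_nat_def)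
  also have "\<dots> \<longleftrightarrow> escape lam G tree_root = 0"
  proof -
    have S: "0 \<le> ?S"
      using lam by (simp add: sum_nonneg escape_nonneg)
    have "escape lam G tree_root = series_step (lam * ?S)"
      using lam by (intro escape_rec) simp
    moreover have "0 < series_step (lam * ?S)" if "?S \<noteq> 0"
      using lam S that by (intro series_step_pos mult_pos_pos) auto
    ultimately show ?thesis
      by (cases "?S = 0") (auto simp: series_step_def)
  qed
  finally show ?thesis .
qed

section \<open>Continuity\<close>

definition radius :: "site \<Rightarrow> int" where
  "radius p = max \<bar>fst p\<bar> \<bar>snd p\<bar>"

definition record_walks :: "site set \<Rightarrow> site list set" where
  "record_walks G = {w \<in> saw_tree G. \<forall>p\<in>set (butlast w). radius p < radius (last w)}"

text \<open>The coordinate 0 counts as positive, so that moving outward from a site on the boundary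
  of the half-plane or of the quadrant stays inside.\<close>

definition outward :: "int \<Rightarrow> int \<Rightarrow> int" where
  "outward c a = (if 0 \<le> c then c + a else c - a)"

definition outward_closed :: "site set \<Rightarrow> bool" where
  "outward_closed G \<longleftrightarrow> (\<forall>p\<in>G. \<forall>q\<in>quadrant. (outward (fst p) (fst q), outward (snd p) (snd q)) \<in> G)"

lemma outward_closed_plane: "outward_closed plane"
  by (simp add: outward_closed_def plane_def)

lemma outward_closed_half_plane: "outward_closed half_plane"
  by (auto simp: outward_closed_def half_plane_def quadrant_def outward_def)

lemma outward_closed_quadrant: "outward_closed quadrant"
  by (auto simp: outward_closed_def quadrant_def outward_def)

lemma successively_butlast: "successively P w \<Longrightarrow> successively P (butlast w)"
  by (cases w rule: rev_cases) (auto simp: successively_append_iff)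

lemma finite_radius_le: "finite {p. radius p \<le> m}"
proof (rule finite_subset)
  show "{p. radius p \<le> m} \<subseteq> {-m..m} \<times> {-m..m}"
    by (auto simp: radius_def)
qed auto

text \<open>Beyond the site where a walk sets a new record of distance, a whole quadrant is free.\<close>

lemma escape_quadrant_le_record:
  assumes lam: "0 \<le> lam" and G: "outward_closed G" and w: "w \<in> record_walks G"
  shows "escape lam quadrant tree_root \<le> escape lam G w"
proof -
  \<comment> \<open>\<open>h\<close> maps the quadrant onto the one with corner
    \<open>last w\<close> that points away from the origin, and \<open>e\<close> grafts a quadrant
    walk there. As \<open>h\<close> sends the origin to \<open>last w\<close>, that site is dropped
    from \<open>w\<close>. Earlier sites of \<open>w\<close> have smaller radius than all images
    under \<open>h\<close>, so no site repeats.\<close>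
  define h where "h q = (outward (fst (last w)) (fst q), outward (snd (last w)) (snd q))" for q
  define e where "e v = butlast w @ map h v" for v
  have w': "w \<noteq> []" "hd w = (0, 0)" "set w \<subseteq> G" "distinct w" "successively lattice_adj w"
    using w by (auto simp: record_walks_def saw_tree_def)
  have last: "last w \<in> G"
    using w' by auto
  have inj: "inj h"
    by (auto simp: inj_def h_def outward_def split: if_splits)
  have h0: "h (0, 0) = last w"
    by (simp add: h_def outward_def)
  have rad: "radius (last w) \<le> radius (h q)" if "q \<in> quadrant" for q
    using that by (auto simp: radius_def h_def outward_def quadrant_def)
  have adj: "lattice_adj (h p) (h q)" if "lattice_adj p q" for p q
    using that by (auto simp: lattice_adj_def h_def outward_def)
  have e: "e v \<in> saw_tree G" if v: "v \<in> saw_tree quadrant" for v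
  proof -
    have v': "v \<noteq> []" "hd v = (0, 0)" "set v \<subseteq> quadrant" "distinct v" "successively lattice_adj v"
      using v by (auto simp: saw_tree_def)
    have "hd (e v) = (0, 0)"
      using w' v' h0 by (cases w rule: rev_cases) (auto simp: e_def hd_append hd_map)
    moreover have "set (e v) \<subseteq> G"
      using w' v' last G by (auto simp: e_def h_def outward_closed_def dest: in_set_butlastD)
    moreover have "distinct (e v)"
    proof -
      have "h q \<notin> set (butlast w)" if "q \<in> set v" for q
        using w rad[of q] that v' by (force simp: record_walks_def)
      then show ?thesis
        using w' v' inj by (auto simp: e_def distinct_butlast distinct_map intro: inj_on_subset)
    qed
    moreover have "successively lattice_adj (e v)"
    proof -
      have "successively lattice_adj (map h v)"
        unfolding successively_map using v' adj by (auto elim: successively_mono)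
      moreover have "lattice_adj (last (butlast w)) (hd (map h v))" if "butlast w \<noteq> []"
        using w' v' h0 that by (cases w rule: rev_cases) (auto simp: successively_append_iff hd_map)
      ultimately show ?thesis
        using w' successively_butlast[of lattice_adj w] by (auto simp: e_def successively_append_iff)
    qed
    ultimately show ?thesis
      using v' by (simp add: saw_tree_def e_def)
  qed
  have "e y \<in> kids G (e v)" if "y \<in> kids quadrant v" for v y
    using that e[of y] by (auto simp: children_def e_def)
  moreover have "inj_on e (saw_tree quadrant)"
    using inj by (auto simp: inj_on_def e_def map_eq_conv inj_map_eq_map)
  moreover have "tree_root \<in> saw_tree quadrant"
    by (simp add: saw_tree_def tree_root_def quadrant_def)
  ultimately have "escape lam quadrant tree_root \<le> escape lam G (e tree_root)"
    using lam by (intro escape_embedding)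
  also have "e tree_root = w"
    using w' by (simp add: e_def tree_root_def h0)
  finally show ?thesis .
qed

text \<open>A self-avoiding walk confined to a box has bounded length. Hence every branch below
  \<open>w\<close> stops or leaves the box after boundedly many steps, and it leaves through a
  record walk. The bound climbs back from there by \<open>series_step_scale_ge\<close>.\<close>

lemma ratio_propagates_from_records:
  fixes s t :: "site list \<Rightarrow> real"
  assumes lam: "0 \<le> lam" and s: "\<And>w. s w = series_step (lam * (\<Sum>y\<in>kids G w. s y))"
    and t: "\<And>w. t w = series_step (lam * (\<Sum>y\<in>kids G w. t y))"
    and nonneg: "\<And>w. 0 \<le> s w" and k: "0 \<le> k" "k \<le> 1"
    and rec: "\<And>w. w \<in> record_walks G \<Longrightarrow> k * s w \<le> t w" and w: "w \<in> saw_tree G"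
  shows "k * s w \<le> t w"
proof -
  define m where "m = Max (radius ` set w)"
  define N where "N = card {p. radius p \<le> m}"
  have short: "length v \<le> N" if "v \<in> saw_tree G" "\<forall>p\<in>set v. radius p \<le> m" for v
  proof -
    have "card (set v) \<le> N"
      unfolding N_def using that by (intro card_mono finite_radius_le) auto
    then show ?thesis
      using that by (simp add: saw_tree_def distinct_card)
  qed
  \<comment> \<open>Induction on the length still available inside the box; for \<open>j = 0\<close>
    no such walk exists, as its length would exceed \<open>N\<close>.\<close>
  have "k * s v \<le> t v" if "v \<in> saw_tree G" "\<forall>p\<in>set v. radius p \<le> m" "length v + j = Suc N" for j v
    using that
  proof (induction j arbitrary: v)
    case 0
    then show ?case using short[of v] by simp
  next
    case (Suc j)
    have kid: "k * s y \<le> t y" if y: "y \<in> kids G v" for y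
    proof -
      obtain p where p: "y = v @ [p]" "y \<in> saw_tree G"
        using y by (auto simp: children_def)
      show ?thesis
      proof (cases "radius p \<le> m")
        case True
        then show ?thesis using Suc.IH[of y] Suc.prems p by simp
      next
        case False
        \<comment> \<open>The new site is the first one outside the box of radius
          \<open>m\<close>.\<close>
        then have "y \<in> record_walks G"
          using p Suc.prems by (force simp: record_walks_def)
        then show ?thesis by (rule rec)
      qed
    qed
    have "k * s v \<le> series_step (k * (lam * (\<Sum>y\<in>kids G v. s y)))"
      using lam k nonneg by (subst s) (intro series_step_scale_ge mult_nonneg_nonneg sum_nonneg)
    also have "k * (lam * (\<Sum>y\<in>kids G v. s y)) = lam * (\<Sum>y\<in>kids G v. k * s y)"
      by (simp add: sum_distrib_left mult.left_commute)
    also have "series_step \<dots> \<le> series_step (lam * (\<Sum>y\<in>kids G v. t y))"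
      using lam k nonneg kid by (intro series_step_mono mult_left_mono sum_mono mult_nonneg_nonneg sum_nonneg)
    finally show ?case
      using t[of v] by simp
  qed
  moreover have "\<forall>p\<in>set w. radius p \<le> m"
    by (simp add: m_def)
  ultimately show ?thesis
    using w short[of w] by (metis le_SucI le_add_diff_inverse)
qed

text \<open>If \<open>t \<ge> k s\<close> on the record walks, then the recursion improves \<open>k\<close> to
  \<open>k (1 + a) / (1 + k a)\<close> there, so that the best such \<open>k\<close> is \<open>1\<close>.\<close>

lemma recursion_solution_unique:
  fixes s t :: "site list \<Rightarrow> real"
  assumes lam: "0 \<le> lam" and s: "\<And>w. s w = series_step (lam * (\<Sum>y\<in>kids G w. s y))"
    and t: "\<And>w. t w = series_step (lam * (\<Sum>y\<in>kids G w. t y))"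
    and bounds: "\<And>w. 0 \<le> t w" "\<And>w. t w \<le> s w" "\<And>w. s w \<le> 1"
    and a: "0 < a" "a \<le> 1" "\<And>w. w \<in> record_walks G \<Longrightarrow> a \<le> t w"
    and w: "w \<in> saw_tree G"
  shows "t w = s w"
proof -
  define K where "K = {k. 0 \<le> k \<and> k \<le> 1 \<and> (\<forall>w\<in>record_walks G. k * s w \<le> t w)}"
  define c where "c = Sup K"
  have s0: "0 \<le> s w" for w
    using bounds(1,2) by (rule order_trans)
  have aK: "a \<in> K"
  proof -
    have "a * s w \<le> t w" if "w \<in> record_walks G" for w
    proof -
      have "a * s w \<le> a * 1"
        using a(1) bounds(3) by (intro mult_left_mono) auto
      then show ?thesis
        using a(3)[OF that] by simp
    qed
    then show ?thesis
      using a by (auto simp: K_def)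
  qed
  have bdd: "bdd_above K"
    by (auto simp: K_def intro: bdd_aboveI[of _ 1])
  have ac: "a \<le> c"
    unfolding c_def using aK bdd by (rule cSup_upper)
  have c1: "c \<le> 1"
    unfolding c_def using aK by (intro cSup_least) (auto simp: K_def)
  have c: "c * s w \<le> t w" if w: "w \<in> record_walks G" for w
  proof -
    have pos: "0 < s w"
      using a(1) a(3)[OF w] bounds(2)[of w] by linarith
    have "c \<le> t w / s w"
      unfolding c_def using aK w pos by (intro cSup_least) (auto simp: K_def field_simps)
    then show ?thesis
      using pos by (simp add: field_simps)
  qed
  have all: "c * s v \<le> t v" if "v \<in> saw_tree G" for v
    using ratio_propagates_from_records[OF lam s t s0 _ c1 c that] ac a by simp
  have den: "0 < 1 + c * a"
    using a ac by (intro add_pos_nonneg mult_nonneg_nonneg) auto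
  have "c * (1 + a) / (1 + c * a) \<in> K"
  proof -
    have "c * (1 + a) / (1 + c * a) * s v \<le> t v" if v: "v \<in> record_walks G" for v
    proof -
      let ?u = "lam * (\<Sum>y\<in>kids G v. s y)"
      have u: "0 \<le> ?u"
        using lam s0 by (intro mult_nonneg_nonneg sum_nonneg)
      have "a \<le> series_step ?u"
        using a(3)[OF v] bounds(2)[of v] s[of v] by simp
      then have "c * (1 + a) / (1 + c * a) * s v \<le> series_step (c * ?u)"
        using u a ac c1 by (subst s) (intro series_step_scale_gain, auto)
      also have "c * ?u = lam * (\<Sum>y\<in>kids G v. c * s y)"
        by (simp add: sum_distrib_left mult.left_commute)
      also have "series_step \<dots> \<le> series_step (lam * (\<Sum>y\<in>kids G v. t y))"
        using lam s0 ac a all[OF subsetD[OF kids_subset]]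
        by (intro series_step_mono mult_left_mono sum_mono mult_nonneg_nonneg sum_nonneg) auto
      finally show ?thesis
        using t[of v] by simp
    qed
    moreover have "c * (1 + a) \<le> 1 + c * a"
      using c1 by (simp add: algebra_simps)
    ultimately show ?thesis
      using den a ac by (auto simp: K_def divide_simps)
  qed
  then have "c * (1 + a) / (1 + c * a) \<le> c"
    unfolding c_def using bdd by (rule cSup_upper)
  then have "c * (1 + a) \<le> c * (1 + c * a)"
    using den by (simp add: divide_simps)
  \<comment> \<open>Cancel the positive factor \<open>c\<close>. Together with
    \<open>c \<le> 1\<close> this leaves only \<open>c = 1\<close>.\<close>
  then have "a \<le> c * a"
    using ac a by simp
  then have "c = 1"
    using a c1 by simp
  then show ?thesis
    using all[OF w] bounds(2)[of w] by simp
qed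

text \<open>The pointwise limit solves the recursion at \<open>lam\<close> because the sums are
  finite. It is at most \<open>escape\<close> by maximality, and on record walks it is at least the
  quadrant value at \<open>lam1\<close>, uniformly along the sequence. Uniqueness identifies the
  two.\<close>

lemma escape_LIMSEQ:
  assumes G: "outward_closed G" and lam1: "0 \<le> lam1" "0 < escape lam1 quadrant tree_root"
    and l: "l \<longlonglongrightarrow> lam" "\<And>k. lam1 \<le> l k"
    and conv: "\<And>w. convergent (\<lambda>k. escape (l k) G w)" and w: "w \<in> saw_tree G"
  shows "(\<lambda>k. escape (l k) G w) \<longlonglongrightarrow> escape lam G w"
proof -
  define t where "t w = lim (\<lambda>k. escape (l k) G w)" for w
  have t: "(\<lambda>k. escape (l k) G w) \<longlonglongrightarrow> t w" for w
    using conv by (simp add: t_def convergent_LIMSEQ_iff)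
  have l0: "0 \<le> l k" for k
    using lam1(1) l(2)[of k] by linarith
  have lam: "0 \<le> lam"
    by (rule LIMSEQ_le_const[OF l(1)]) (use l0 in auto)
  have t0: "0 \<le> t w" for w
    by (rule LIMSEQ_le_const[OF t]) (use l0 escape_nonneg in auto)
  have t1: "t w \<le> 1" for w
    by (rule LIMSEQ_le_const2[OF t]) (use l0 escape_le_1 in auto)
  have fix_t: "t w = series_step (lam * (\<Sum>y\<in>kids G w. t y))" for w
  proof (rule LIMSEQ_unique[OF t])
    have "(\<lambda>k. series_step (l k * (\<Sum>y\<in>kids G w. escape (l k) G y)))
        \<longlonglongrightarrow> series_step (lam * (\<Sum>y\<in>kids G w. t y))"
      using lam t0 by (intro tendsto_series_step tendsto_intros t l mult_nonneg_nonneg sum_nonneg)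
    then show "(\<lambda>k. escape (l k) G w) \<longlonglongrightarrow> series_step (lam * (\<Sum>y\<in>kids G w. t y))"
      by (simp flip: escape_rec[OF l0])
  qed
  have le: "t w \<le> escape lam G w" for w
    by (rule escape_greatest[OF lam t0 t1]) (simp flip: fix_t)
  have rec: "escape lam1 quadrant tree_root \<le> t v" if "v \<in> record_walks G" for v
  proof (rule LIMSEQ_le_const[OF t], intro exI allI impI)
    fix k
    show "escape lam1 quadrant tree_root \<le> escape (l k) G v"
      using escape_mono[OF lam1(1) l(2)[of k]] escape_quadrant_le_record[OF l0 G that]
      by (rule order_trans)
  qed
  have "t w = escape lam G w"
    using recursion_solution_unique[OF lam escape_rec[OF lam] fix_t t0 le escape_le_1[OF lam] lam1(2) _ rec w]
      escape_le_1[OF lam1(1)] by blast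
  then show ?thesis
    using t[of w] by simp
qed

text \<open>By monotonicity one point on each side of \<open>x\<close> controls the function on a
  whole neighbourhood.\<close>

lemma isCont_mono_squeeze:
  fixes f :: "real \<Rightarrow> real"
  assumes mono: "\<And>u v. c \<le> u \<Longrightarrow> u \<le> v \<Longrightarrow> f u \<le> f v"
    and a: "(\<lambda>k. f (a k)) \<longlonglongrightarrow> f x" "\<And>k. c \<le> a k" "\<And>k. a k < x"
    and b: "(\<lambda>k. f (b k)) \<longlonglongrightarrow> f x" "\<And>k. x < b k"
  shows "isCont f x"
  unfolding isCont_def
proof (rule order_tendstoI)
  fix y assume "y < f x"
  then obtain k where k: "y < f (a k)"
    using order_tendstoD(1)[OF a(1)] by (auto simp: eventually_sequentially)
  have "\<forall>\<^sub>F u in at x. a k < u"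
    using order_tendstoD(1)[OF tendsto_ident_at a(3)] .
  then show "\<forall>\<^sub>F u in at x. y < f u"
    by eventually_elim (use k mono[OF a(2)] in \<open>meson less_imp_le less_le_trans\<close>)
next
  fix y assume "f x < y"
  then obtain k where k: "f (b k) < y"
    using order_tendstoD(2)[OF b(1)] by (auto simp: eventually_sequentially)
  have "\<forall>\<^sub>F u in at x. u < b k" "\<forall>\<^sub>F u in at x. a 0 < u"
    using order_tendstoD(2)[OF tendsto_ident_at b(2)] order_tendstoD(1)[OF tendsto_ident_at a(3)] by auto
  then show "\<forall>\<^sub>F u in at x. f u < y"
  proof eventually_elim
    case (elim u)
    then have "f u \<le> f (b k)"
      using a(2)[of 0] by (intro mono) auto
    then show ?case using k by simp
  qed
qed

lemma escape_isCont:
  assumes G: "outward_closed G" and lam1: "0 \<le> lam1" "lam1 < lam" "0 < escape lam1 quadrant tree_root"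
    and w: "w \<in> saw_tree G"
  shows "isCont (\<lambda>l. escape l G w) lam"
proof -
  \<comment> \<open>The increasing sequence starts at \<open>a 0 = lam1\<close>, so both sequences
    stay where the lower bound on record walks is available.\<close>
  define a where "a k = lam - (lam - lam1) / Suc k" for k :: nat
  define b where "b k = lam + (lam - lam1) / Suc k" for k :: nat
  have lim: "(\<lambda>k. (lam - lam1) / Suc k) \<longlonglongrightarrow> 0"
    using tendsto_mult[OF tendsto_const[of "lam - lam1"] LIMSEQ_inverse_real_of_nat]
    by (simp add: divide_inverse)
  have a_lim: "a \<longlonglongrightarrow> lam"
    unfolding a_def using tendsto_diff[OF tendsto_const[of lam] lim] by simp
  have b_lim: "b \<longlonglongrightarrow> lam"
    unfolding b_def using tendsto_add[OF tendsto_const[of lam] lim] by simp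
  have dec: "(lam - lam1) / Suc k' \<le> (lam - lam1) / Suc k" if "k \<le> k'" for k k' :: nat
    using lam1 that by (intro divide_left_mono) auto
  have a_lam1: "lam1 \<le> a k" for k
    using dec[of 0 k] by (simp add: a_def)
  have a_lam: "a k < lam" for k
    using lam1 by (simp add: a_def)
  have b_lam: "lam < b k" for k
    using lam1 by (simp add: b_def)
  have mono: "escape u G v \<le> escape u' G v" if "lam1 \<le> u" "u \<le> u'" for u u' v
    using that lam1 by (intro escape_mono) auto
  have "incseq (\<lambda>k. escape (a k) G v)" for v
    unfolding incseq_def using dec a_lam1 by (auto intro!: mono simp: a_def)
  then have "convergent (\<lambda>k. escape (a k) G v)" for v
    using incseq_convergent[of "\<lambda>k. escape (a k) G v" 1] escape_le_1[OF order_trans[OF lam1(1) a_lam1]]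
    by (metis convergent_def)
  then have A: "(\<lambda>k. escape (a k) G w) \<longlonglongrightarrow> escape lam G w"
    using G lam1 a_lim a_lam1 w by (intro escape_LIMSEQ)
  have b_lam1: "lam1 \<le> b k" for k
    using lam1(2) b_lam[of k] by linarith
  have "decseq (\<lambda>k. escape (b k) G v)" for v
    unfolding decseq_def using dec b_lam1 by (auto intro!: mono simp: b_def)
  then have "convergent (\<lambda>k. escape (b k) G v)" for v
    using decseq_convergent[of "\<lambda>k. escape (b k) G v" 0] escape_nonneg[OF order_trans[OF lam1(1) b_lam1]]
    by (metis convergent_def)
  then have B: "(\<lambda>k. escape (b k) G w) \<longlonglongrightarrow> escape lam G w"
    using G lam1 b_lim b_lam1 w by (intro escape_LIMSEQ)
  show ?thesis
    using mono A a_lam1 a_lam B b_lam by (rule isCont_mono_squeeze)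
qed

section \<open>The Hammersley--Welsh inequality\<close>

text \<open>Neither a starting site nor a domain is prescribed, so this notion passes to pieces,
  reversals and translates.\<close>

definition saw_path :: "site list \<Rightarrow> bool" where
  "saw_path w \<longleftrightarrow> distinct w \<and> successively lattice_adj w"

lemma saw_tree_plane_iff: "w \<in> saw_tree plane \<longleftrightarrow> w \<noteq> [] \<and> hd w = (0, 0) \<and> saw_path w"
  by (auto simp: saw_tree_def plane_def saw_path_def)

lemma saw_path_map:
  assumes "saw_path w" "inj h" "\<And>p q. lattice_adj p q \<Longrightarrow> lattice_adj (h p) (h q)"
  shows "saw_path (map h w)"
  using assms unfolding saw_path_def
  by (auto simp: distinct_map successively_map intro: inj_on_subset elim: successively_mono)

lemma saw_path_appendD: "saw_path (u @ v) \<Longrightarrow> saw_path u" "saw_path (u @ v) \<Longrightarrow> saw_path v"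
  by (auto simp: saw_path_def successively_append_iff)

lemma lattice_adj_commute: "lattice_adj p q \<longleftrightarrow> lattice_adj q p"
  by (simp add: lattice_adj_def abs_minus_commute)

lemma saw_path_rev: "saw_path (rev w) \<longleftrightarrow> saw_path w"
  by (simp add: saw_path_def lattice_adj_commute)

lemma lattice_adj_translate: "lattice_adj p q \<Longrightarrow> lattice_adj (p + c) (q + c)"
  by (simp add: lattice_adj_def)

lemma inj_translate: "inj (\<lambda>p :: site. p + c)"
  by (auto simp: inj_def)

lemma saw_path_translate: "saw_path w \<Longrightarrow> saw_path (map (\<lambda>p. p + c) w)"
  by (erule saw_path_map) (auto intro: inj_translate lattice_adj_translate)

lemma saw_tree_prefix:
  assumes "u @ v \<in> saw_tree G" "u \<noteq> []"
  shows "u \<in> saw_tree G"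
  using assms by (auto simp: saw_tree_def successively_append_iff)

lemma radius_lt_length:
  assumes "w \<in> saw_tree G" "p \<in> set w"
  shows "radius p < length w"
  using assms
proof (induction w arbitrary: p rule: rev_induct)
  case (snoc q w)
  show ?case
  proof (cases "w = []")
    case True
    then show ?thesis using snoc.prems by (auto simp: saw_tree_def radius_def)
  next
    case False
    then have w: "w \<in> saw_tree G"
      using snoc.prems saw_tree_prefix by blast
    have "radius q \<le> radius (last w) + 1"
      using snoc.prems False by (auto simp: saw_tree_def successively_append_iff lattice_adj_def radius_def)
    then have "radius q < length (w @ [q])"
      using snoc.IH[OF w last_in_set[OF False]] by simp
    then show ?thesis
      using snoc.IH[OF w, of p] snoc.prems by auto
  qed
qed simp

lemma finite_saw_tree_length_le: "finite {w \<in> saw_tree G. length w \<le> n}"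
proof (rule finite_subset)
  show "{w \<in> saw_tree G. length w \<le> n} \<subseteq> {w. set w \<subseteq> {p. radius p \<le> int n} \<and> length w \<le> n}"
    using radius_lt_length by force
  show "finite {w. set w \<subseteq> {p. radius p \<le> int n} \<and> length w \<le> n}"
    by (rule finite_lists_length_le[OF finite_radius_le])
qed

lemma finite_saws: "X \<subseteq> saw_tree G \<Longrightarrow> \<forall>w\<in>X. length w \<le> n \<Longrightarrow> finite X"
  by (rule finite_subset[OF _ finite_saw_tree_length_le[of G n]]) auto

section \<open>Truncated generating functions by number of steps\<close>

definition weight :: "real \<Rightarrow> site list set \<Rightarrow> real" where
  "weight lam X = (\<Sum>w\<in>X. lam ^ depth w)"

lemma weight_nonneg: "0 \<le> lam \<Longrightarrow> 0 \<le> weight lam X"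
  by (simp add: weight_def sum_nonneg)

lemma weight_mono: "0 \<le> lam \<Longrightarrow> finite Y \<Longrightarrow> X \<subseteq> Y \<Longrightarrow> weight lam X \<le> weight lam Y"
  unfolding weight_def by (rule sum_mono2) auto

lemma weight_levels:
  assumes "X \<subseteq> saw_tree G"
  shows "weight lam {w \<in> X. length w \<le> Suc N} = (\<Sum>n\<le>N. real (card {w \<in> X. length w = Suc n}) * lam ^ n)"
proof -
  have "length w \<noteq> 0" if "w \<in> X" for w
    using that assms by (auto simp: saw_tree_def)
  then have "length w \<le> Suc N \<longleftrightarrow> (\<exists>n\<in>{..N}. length w = Suc n)" if "w \<in> X" for w
    using that by (cases "length w") auto
  then have "{w \<in> X. length w \<le> Suc N} = (\<Union>n\<in>{..N}. {w \<in> X. length w = Suc n})"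
    by blast
  moreover have "finite {w \<in> X. length w = Suc n}" for n
    using assms by (intro finite_saws[of _ G "Suc n"]) auto
  ultimately have "weight lam {w \<in> X. length w \<le> Suc N} =
      (\<Sum>n\<le>N. \<Sum>w\<in>{w \<in> X. length w = Suc n}. lam ^ depth w)"
    unfolding weight_def by (subst sum.UNION_disjoint[symmetric]) auto
  also have "\<dots> = (\<Sum>n\<le>N. real (card {w \<in> X. length w = Suc n}) * lam ^ n)"
    by (intro sum.cong refl) (simp add: depth_def)
  finally show ?thesis .
qed

text \<open>The pairs need only cover \<open>Z\<close>; gluing may fail to be injective. The
  exponent \<open>k\<close> counts the steps of the two pieces that gluing discards.\<close>

lemma weight_product_le:
  assumes lam: "0 \<le> lam" and fin: "finite X" "finite Y" and sub: "Z \<subseteq> (\<lambda>(u, v). f u v) ` (X \<times> Y)"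
    and depth: "\<And>u v. u \<in> X \<Longrightarrow> v \<in> Y \<Longrightarrow> lam ^ k * lam ^ depth (f u v) = lam ^ depth u * lam ^ depth v"
  shows "lam ^ k * weight lam Z \<le> weight lam X * weight lam Y"
proof -
  have "lam ^ k * weight lam Z \<le> lam ^ k * weight lam ((\<lambda>(u, v). f u v) ` (X \<times> Y))"
    using lam fin sub by (intro mult_left_mono weight_mono) auto
  also have "weight lam ((\<lambda>(u, v). f u v) ` (X \<times> Y)) \<le> (\<Sum>(u, v)\<in>X \<times> Y. lam ^ depth (f u v))"
    unfolding weight_def using lam fin
    by (intro order_trans[OF sum_image_le]) (auto simp: case_prod_unfold)
  also have "lam ^ k * (\<Sum>(u, v)\<in>X \<times> Y. lam ^ depth (f u v)) = (\<Sum>(u, v)\<in>X \<times> Y. lam ^ depth u * lam ^ depth v)"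
    unfolding sum_distrib_left by (intro sum.cong refl) (auto simp: depth)
  also have "\<dots> = weight lam X * weight lam Y"
    by (simp add: weight_def sum_product sum.cartesian_product)
  finally show ?thesis
    using lam by (simp add: mult_left_mono)
qed

section \<open>Half-plane walks and their decomposition into bridges\<close>

definition half_walks :: "site list set" where
  "half_walks = {w \<in> saw_tree plane. \<forall>p\<in>set (tl w). 0 < fst p}"

definition bridges :: "site list set" where
  "bridges = {w \<in> half_walks. \<forall>p\<in>set w. fst p \<le> fst (last w)}"

definition half_walks_upto :: "nat \<Rightarrow> int \<Rightarrow> site list set" where
  "half_walks_upto N A = {w \<in> half_walks. length w \<le> Suc N \<and> (\<forall>p\<in>set w. fst p \<le> A)}"

definition bridges_upto :: "nat \<Rightarrow> int \<Rightarrow> site list set" where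
  "bridges_upto N A = {w \<in> bridges. length w \<le> Suc N \<and> fst (last w) = A}"

lemma half_walks_subset: "half_walks \<subseteq> saw_tree plane"
  by (auto simp: half_walks_def)

lemma bridges_subset: "bridges \<subseteq> half_walks"
  by (auto simp: bridges_def)

lemma finite_half_walks_upto: "finite (half_walks_upto N A)"
  by (rule finite_saws[of _ plane "Suc N"]) (use half_walks_subset in \<open>auto simp: half_walks_upto_def\<close>)

lemma finite_bridges_upto: "finite (bridges_upto N A)"
  by (rule finite_saws[of _ plane "Suc N"])
    (use half_walks_subset bridges_subset in \<open>auto simp: bridges_upto_def\<close>)

lemma split_list_last_max:
  fixes f :: "'a \<Rightarrow> int"
  assumes "w \<noteq> []"
  obtains u c v where "w = u @ c # v" "\<And>q. q \<in> set w \<Longrightarrow> f q \<le> f c" "\<And>q. q \<in> set v \<Longrightarrow> f q < f c"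
proof -
  have "Max (f ` set w) \<in> f ` set w"
    using assms by (intro Max_in) auto
  then have "\<exists>x\<in>set w. f x = Max (f ` set w)"
    by auto
  from split_list_last_prop[OF this] obtain u c v where
    w: "w = u @ c # v" "f c = Max (f ` set w)" "\<forall>q\<in>set v. f q \<noteq> Max (f ` set w)"
    by blast
  have le: "f q \<le> f c" if "q \<in> set w" for q
    using that w(2) by simp
  moreover have "f q < f c" if "q \<in> set v" for q
  proof -
    have "f q \<noteq> f c"
      using w(2,3) that by metis
    moreover have "q \<in> set w"
      using w(1) that by simp
    ultimately show ?thesis
      using le[of q] by linarith
  qed
  ultimately show ?thesis
    using that w(1) by blast
qed

text \<open>One step of the Hammersley--Welsh unfolding: what follows the last visit to the line of
  maximal abscissa is reflected in that line.\<close>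

definition reflect_glue :: "site list \<Rightarrow> site list \<Rightarrow> site list" where
  "reflect_glue u v = u @ map (\<lambda>q. (fst (last u) - fst q, snd q + snd (last u))) (tl v)"

text \<open>The part up to the last visit to the line of abscissa \<open>Suc A\<close> is a bridge.
  The rest has abscissas from 1 to \<open>A\<close>, so its reflection is a half-plane walk that
  reaches abscissa \<open>A\<close> at most: the span drops with each unfolding.\<close>

lemma half_walks_unfold:
  assumes w: "w \<in> half_walks_upto N (int (Suc A))" and new: "w \<notin> half_walks_upto N (int A)"
  shows "w \<in> (\<lambda>(u, v). reflect_glue u v) ` (bridges_upto N (int (Suc A)) \<times> half_walks_upto N (int A))"
proof -
  have w': "w \<noteq> []" "hd w = (0, 0)" "saw_path w" "\<forall>p\<in>set (tl w). 0 < fst p" "length w \<le> Suc N"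
    "\<And>p. p \<in> set w \<Longrightarrow> fst p \<le> int (Suc A)"
    using w by (auto simp: half_walks_upto_def half_walks_def saw_tree_plane_iff)
  obtain u c v where s: "w = u @ c # v" "\<And>q. q \<in> set w \<Longrightarrow> fst q \<le> fst c" "\<And>q. q \<in> set v \<Longrightarrow> fst q < fst c"
    using split_list_last_max[OF w'(1), of fst] by blast
  have c: "fst c = int (Suc A)"
  proof -
    obtain p where "p \<in> set w" "int A < fst p"
      using w new by (force simp: half_walks_upto_def)
    then show ?thesis
      using s(2)[of p] w'(6)[of c] s(1) by auto
  qed
  define h where "h q = (fst c - fst q, snd q - snd c)" for q :: site
  define v' where "v' = map h (c # v)"
  have b: "u @ [c] \<in> bridges_upto N (int (Suc A))"
  proof -
    have "saw_path (u @ [c])"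
      using w'(3) saw_path_appendD(1)[of "u @ [c]" v] by (simp add: s(1))
    moreover have "hd (u @ [c]) = (0, 0)" "\<forall>p\<in>set (tl (u @ [c])). 0 < fst p"
      using w'(2,4) by (cases u; auto simp: s(1))+
    ultimately show ?thesis
      using w'(5) s(2) c by (auto simp: bridges_upto_def bridges_def half_walks_def saw_tree_plane_iff s(1))
  qed
  have pos: "0 < fst q" if "q \<in> set v" for q
    using that w'(4) by (cases u) (auto simp: s(1))
  have "v' \<in> half_walks_upto N (int A)"
  proof -
    have "saw_path (c # v)"
      using w'(3) by (auto simp: s(1) intro: saw_path_appendD(2))
    then have "saw_path v'"
      unfolding v'_def by (rule saw_path_map) (auto simp: inj_def h_def lattice_adj_def)
    then have "v' \<in> saw_tree plane"
      by (simp add: saw_tree_plane_iff v'_def h_def)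
    moreover have "0 < fst p" if "p \<in> set (tl v')" for p
      using that s(3) by (auto simp: v'_def h_def)
    moreover have "fst p \<le> int A" if "p \<in> set v'" for p
      using that pos c by (force simp: v'_def h_def)
    moreover have "length v' \<le> Suc N"
      using w'(5) by (simp add: v'_def s(1))
    ultimately show ?thesis
      by (simp add: half_walks_upto_def half_walks_def)
  qed
  moreover have "w = reflect_glue (u @ [c]) v'"
    by (simp add: reflect_glue_def v'_def h_def s(1) comp_def)
  ultimately show ?thesis
    using b by auto
qed

text \<open>The summand 1 accounts for the walks that do not reach the new line, the bridge weight
  for those that are unfolded there.\<close>

lemma weight_half_walks_step:
  assumes lam: "0 \<le> lam"
  shows "weight lam (half_walks_upto N (int (Suc A))) \<le>
    (1 + weight lam (bridges_upto N (int (Suc A)))) * weight lam (half_walks_upto N (int A))"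
proof -
  let ?H = "half_walks_upto N (int A)" and ?H' = "half_walks_upto N (int (Suc A))"
    and ?B = "bridges_upto N (int (Suc A))"
  have "?H \<subseteq> ?H'"
    by (force simp: half_walks_upto_def)
  then have "weight lam ?H' = weight lam (?H' - ?H) + weight lam ?H"
    unfolding weight_def by (intro sum.subset_diff finite_half_walks_upto)
  moreover have "lam ^ 0 * weight lam (?H' - ?H) \<le> weight lam ?B * weight lam ?H"
  proof (rule weight_product_le[OF lam finite_bridges_upto finite_half_walks_upto, where f = reflect_glue])
    show "?H' - ?H \<subseteq> (\<lambda>(u, v). reflect_glue u v) ` (?B \<times> ?H)"
      using half_walks_unfold by blast
    fix u v assume "u \<in> ?B" "v \<in> ?H"
    then have "u \<noteq> []" "v \<noteq> []"
      by (auto simp: bridges_upto_def bridges_def half_walks_upto_def half_walks_def saw_tree_def)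
    then have "depth (reflect_glue u v) = depth u + depth v"
      by (cases u; cases v) (auto simp: depth_def reflect_glue_def)
    then show "lam ^ 0 * lam ^ depth (reflect_glue u v) = lam ^ depth u * lam ^ depth v"
      by (simp add: power_add)
  qed
  ultimately show ?thesis
    by (simp add: algebra_simps)
qed

lemma half_walks_upto_0: "half_walks_upto N 0 \<subseteq> {tree_root}"
proof
  fix w assume "w \<in> half_walks_upto N 0"
  then have "w \<noteq> []" "hd w = (0, 0)" "\<forall>p\<in>set (tl w). 0 < fst p" "\<forall>p\<in>set w. fst p \<le> 0"
    by (auto simp: half_walks_upto_def half_walks_def saw_tree_def)
  then show "w \<in> {tree_root}"
    by (cases w; cases "tl w") (auto simp: tree_root_def)
qed

lemma weight_half_walks_le_prod:
  assumes lam: "0 \<le> lam"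
  shows "weight lam (half_walks_upto N (int A)) \<le> (\<Prod>a\<in>{1..A}. 1 + weight lam (bridges_upto N (int a)))"
proof (induction A)
  case 0
  have "weight lam (half_walks_upto N 0) \<le> weight lam {tree_root}"
    using lam half_walks_upto_0 by (intro weight_mono) auto
  then show ?case
    by (simp add: weight_def depth_def tree_root_def)
next
  case (Suc A)
  have "weight lam (half_walks_upto N (int (Suc A))) \<le>
      (1 + weight lam (bridges_upto N (int (Suc A)))) * (\<Prod>a\<in>{1..A}. 1 + weight lam (bridges_upto N (int a)))"
    using lam by (intro order_trans[OF weight_half_walks_step mult_left_mono] Suc add_nonneg_nonneg weight_nonneg) auto
  then show ?case
    by (simp add: prod.nat_ivl_Suc' mult.commute)
qed

text \<open>The inequality \<open>1 + x \<le> exp x\<close> turns the product over spans into the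
  exponential of a sum over bridges of distinct spans; the bound no longer depends on
  \<open>A\<close>.\<close>

lemma weight_half_walks_le_exp:
  assumes lam: "0 \<le> lam"
  shows "weight lam (half_walks_upto N (int A)) \<le> exp (weight lam {w \<in> bridges. length w \<le> Suc N})"
proof -
  have "weight lam (half_walks_upto N (int A)) \<le> (\<Prod>a\<in>{1..A}. 1 + weight lam (bridges_upto N (int a)))"
    by (rule weight_half_walks_le_prod[OF lam])
  also have "\<dots> \<le> (\<Prod>a\<in>{1..A}. exp (weight lam (bridges_upto N (int a))))"
    using lam by (intro prod_mono) (auto intro: add_nonneg_nonneg weight_nonneg exp_ge_add_one_self)
  also have "\<dots> = exp (\<Sum>a\<in>{1..A}. weight lam (bridges_upto N (int a)))"
    by (simp add: exp_sum)
  also have "(\<Sum>a\<in>{1..A}. weight lam (bridges_upto N (int a))) = weight lam (\<Union>a\<in>{1..A}. bridges_upto N (int a))"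
    unfolding weight_def
    by (intro sum.UNION_disjoint[symmetric] finite_bridges_upto ballI) (auto simp: bridges_upto_def)
  also have "\<dots> \<le> weight lam {w \<in> bridges. length w \<le> Suc N}"
    using bridges_subset half_walks_subset
    by (intro weight_mono[OF lam] finite_saws[of _ plane "Suc N"]) (auto simp: bridges_upto_def)
  finally show ?thesis by simp
qed

text \<open>A walk is cut at its last site of minimal abscissa; the reversed first part is made a strict
  half-plane walk by an extra initial step, whence the exponent \<open>1\<close> below.\<close>

definition rev_glue :: "site list \<Rightarrow> site list \<Rightarrow> site list" where
  "rev_glue a b = map (\<lambda>q. q - last a) (rev (tl a)) @ map (\<lambda>q. q + (hd (tl a) - last a)) (tl b)"

lemma saw_split_at_min:
  assumes w: "w \<in> saw_tree plane" "length w \<le> Suc N"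
  shows "w \<in> (\<lambda>(a, b). rev_glue a b) `
    ({a \<in> half_walks_upto (Suc N) (int (Suc N)). 2 \<le> length a} \<times> half_walks_upto (Suc N) (int (Suc N)))"
proof -
  let ?H = "half_walks_upto (Suc N) (int (Suc N))"
  \<comment> \<open>A walk with at most \<open>N + 1\<close> steps cannot get beyond abscissa
    \<open>N + 1\<close>, so the bound on abscissas comes for free.\<close>
  have H: "x \<in> ?H" if "x \<in> half_walks" "length x \<le> Suc (Suc N)" for x
  proof -
    have "fst p \<le> int (Suc N)" if "p \<in> set x" for p
      using radius_lt_length[of x plane p] subsetD[OF half_walks_subset \<open>x \<in> half_walks\<close>]
        \<open>length x \<le> Suc (Suc N)\<close> that
      by (auto simp: radius_def)
    then show ?thesis
      using that by (simp add: half_walks_upto_def)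
  qed
  have w': "w \<noteq> []" "hd w = (0, 0)" "saw_path w"
    using w by (auto simp: saw_tree_plane_iff)
  obtain u c v where s: "w = u @ c # v" "\<And>q. q \<in> set w \<Longrightarrow> fst c \<le> fst q" "\<And>q. q \<in> set v \<Longrightarrow> fst c < fst q"
    using split_list_last_max[OF w'(1), of "\<lambda>q. - fst q"]
    unfolding neg_le_iff_le neg_less_iff_less by blast
  \<comment> \<open>The first part may visit the minimal line several times, so reversed it is only
    weakly on the right of its start. Moving that start to \<open>(1, 0)\<close> and entering from
    the origin makes the inequality strict.\<close>
  define a where "a = (0, 0) # map (\<lambda>q. q + ((1, 0) - c)) (rev (u @ [c]))"
  define b where "b = map (\<lambda>q. q + (- c)) (c # v)"
  have zero: "(0 :: site) = (0, 0)"
    by (simp add: zero_prod_def)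
  \<comment> \<open>The last site of \<open>a\<close> is the image of the origin of
    \<open>w\<close>; this is how \<open>rev_glue\<close> recovers the translation.\<close>
  have last_a: "last a = (1, 0) - c"
    using w'(2) by (cases u) (auto simp: a_def s(1) last_map last_rev zero[symmetric])
  have "saw_path (u @ [c])" "saw_path (c # v)"
    using w'(3) saw_path_appendD[of "u @ [c]" v] saw_path_appendD[of u "c # v"] by (simp_all add: s(1))
  note path = saw_path_translate[OF this(1)[folded saw_path_rev[of "u @ [c]"]], of "(1, 0) - c"]
    saw_path_translate[OF this(2), of "- c"]
  have pos_a: "0 < fst p" if "p \<in> set (tl a)" for p
    using that s(2) by (force simp: a_def s(1))
  have "saw_path a"
  proof -
    have "(0, 0) \<notin> set (tl a)"
      using pos_a by fastforce
    then show ?thesis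
      using path(1) by (auto simp: saw_path_def a_def lattice_adj_def)
  qed
  then have a: "a \<in> half_walks"
    using pos_a by (simp add: half_walks_def saw_tree_plane_iff a_def)
  have b: "b \<in> half_walks"
    using path(2) s(3) by (auto simp: half_walks_def saw_tree_plane_iff b_def zero_prod_def)
  have "rev_glue a b = w"
    unfolding rev_glue_def last_a by (simp add: a_def b_def s(1) comp_def rev_map algebra_simps)
  moreover have "a \<in> ?H" "b \<in> ?H" "2 \<le> length a"
    using H a b w(2) by (auto simp: a_def b_def s(1))
  ultimately show ?thesis
    by (auto intro!: image_eqI[of _ _ "(a, b)"])
qed

text \<open>The square comes from the two half-plane walks of the cut, and the extra initial step
  costs the factor \<open>lam\<close> and one more unit of length.\<close>

lemma weight_saws_le:
  assumes lam: "0 \<le> lam"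
  shows "lam * weight lam {w \<in> saw_tree plane. length w \<le> Suc N} \<le>
    exp (weight lam {w \<in> bridges. length w \<le> Suc (Suc N)}) ^ 2"
proof -
  let ?H = "half_walks_upto (Suc N) (int (Suc N))"
  let ?H2 = "{a \<in> ?H. 2 \<le> length a}"
  have "lam ^ 1 * weight lam {w \<in> saw_tree plane. length w \<le> Suc N} \<le> weight lam ?H2 * weight lam ?H"
  proof (rule weight_product_le[OF lam _ finite_half_walks_upto, where f = rev_glue])
    show "{w \<in> saw_tree plane. length w \<le> Suc N} \<subseteq> (\<lambda>(a, b). rev_glue a b) ` (?H2 \<times> ?H)"
      using saw_split_at_min by blast
    fix a b assume ab: "a \<in> ?H2" "b \<in> ?H"
    then have "b \<noteq> []"
      by (auto simp: half_walks_upto_def half_walks_def saw_tree_def)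
    then have "Suc (depth (rev_glue a b)) = depth a + depth b"
      using ab by (cases b) (auto simp: depth_def rev_glue_def)
    then show "lam ^ 1 * lam ^ depth (rev_glue a b) = lam ^ depth a * lam ^ depth b"
      by (simp flip: power_add power_Suc)
  qed (simp add: finite_half_walks_upto)
  also have "\<dots> \<le> weight lam ?H * weight lam ?H"
    by (intro mult_right_mono weight_mono lam finite_half_walks_upto weight_nonneg) auto
  also have "\<dots> \<le> exp (weight lam {w \<in> bridges. length w \<le> Suc (Suc N)}) ^ 2"
    unfolding power2_eq_square
    by (intro mult_mono weight_half_walks_le_exp weight_nonneg lam) auto
  finally show ?thesis by simp
qed

text \<open>Once the bridge series converges, the bound in \<open>weight_saws_le\<close> is uniform
  in \<open>N\<close>.\<close>

lemma summable_saws_of_bridges: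
  assumes lam: "0 < lam" and b: "summable (\<lambda>n. real (card {w \<in> bridges. length w = Suc n}) * lam ^ n)"
  shows "summable (\<lambda>n. real (card {w \<in> saw_tree plane. length w = Suc n}) * lam ^ n)"
proof (rule summableI_nonneg_bounded)
  define B where "B = (\<Sum>n. real (card {w \<in> bridges. length w = Suc n}) * lam ^ n)"
  show "0 \<le> real (card {w \<in> saw_tree plane. length w = Suc n}) * lam ^ n" for n
    using lam by simp
  show "(\<Sum>n<N. real (card {w \<in> saw_tree plane. length w = Suc n}) * lam ^ n) \<le> exp B ^ 2 / lam" for N
  proof -
    have "weight lam {w \<in> bridges. length w \<le> Suc (Suc N)} \<le> B"
      unfolding B_def using lam b bridges_subset half_walks_subset
      by (subst weight_levels[of _ plane]) (auto intro!: sum_le_suminf simp del: sum.atMost_Suc)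
    then have "lam * weight lam {w \<in> saw_tree plane. length w \<le> Suc N} \<le> exp B ^ 2"
      using lam weight_saws_le[of lam N] by (intro order_trans[OF weight_saws_le power_mono]) auto
    moreover have "lam * (\<Sum>n<N. real (card {w \<in> saw_tree plane. length w = Suc n}) * lam ^ n) \<le>
        lam * weight lam {w \<in> saw_tree plane. length w \<le> Suc N}"
      using lam by (subst weight_levels[of _ plane]) (auto intro!: sum_mono2)
    ultimately show ?thesis
      using lam by (subst pos_le_divide_eq, simp) (subst mult.commute, linarith)
  qed
qed

section \<open>The critical value\<close>

text \<open>Used with \<open>gam\<close> slightly below \<open>lam\<close>: this absorbs the concavity of \<open>series_step\<close>.\<close>

lemma escape_upto_block:
  fixes lam gam eps :: real
  assumes gam: "0 < gam" "gam < lam" and eps: "0 \<le> eps"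
    and D: "finite D" "\<And>d. d \<in> D \<Longrightarrow> length d = n" "\<And>d. d \<in> D \<Longrightarrow> w @ d \<in> saw_tree G"
    and w: "w \<noteq> []"
    and esc: "\<And>d. d \<in> D \<Longrightarrow> eps \<le> escape_upto k lam G (w @ d)"
    and small: "max 1 gam ^ n * (card D * eps) \<le> (lam - gam) / (gam * lam)"
  shows "gam ^ n * (card D * eps) \<le> escape_upto (n + k) lam G w"
  using D w esc small
proof (induction n arbitrary: w D)
  case 0
  have lam: "0 \<le> lam" using gam by linarith
  show ?case
  proof (cases "D = {}")
    case True
    then show ?thesis using escape_upto_nonneg[OF lam] by simp
  next
    case False
    then have "D = {[]}"
      using 0 by auto
    then show ?thesis using 0 by simp
  qed
next
  case (Suc n)
  \<comment> \<open>The blocks that start with the step to the child \<open>y\<close>, with that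
    step removed.\<close>
  define E where "E y = {d. last y # d \<in> D}" for y
  define x where "x = gam ^ n * (card D * eps)"
  have lam: "0 < lam" using gam by linarith
  have x0: "0 \<le> x"
    using gam eps by (simp add: x_def)
  have fin: "finite (E y)" for y
  proof (rule finite_subset)
    show "E y \<subseteq> tl ` D"
      by (force simp: E_def)
  qed (use Suc.prems in simp)
  have card: "card (E y) \<le> card D" for y
  proof -
    have "card ((#) (last y) ` E y) \<le> card D"
      using Suc.prems by (intro card_mono) (auto simp: E_def)
    then show ?thesis
      by (simp add: card_image)
  qed
  have IH: "gam ^ n * (card (E y) * eps) \<le> escape_upto (n + k) lam G y" if y: "y \<in> kids G w" for y
  proof (rule Suc.IH[OF fin])
    obtain p where p: "y = w @ [p]"
      using y by (auto simp: children_def)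
    show "length d = n" "y @ d \<in> saw_tree G" "eps \<le> escape_upto k lam G (y @ d)" if "d \<in> E y" for d
      using Suc.prems(2,3,5)[of "p # d"] that p by (auto simp: E_def)
    show "y \<noteq> []" by (simp add: p)
    \<comment> \<open>With \<open>max 1 gam\<close> instead of \<open>gam\<close> the smallness
      condition passes to shorter blocks also when \<open>gam < 1\<close>.\<close>
    have "max 1 gam ^ n * (card (E y) * eps) \<le> max 1 gam ^ Suc n * (card D * eps)"
      using card[of y] eps by (intro mult_mono power_increasing) auto
    then show "max 1 gam ^ n * (card (E y) * eps) \<le> (lam - gam) / (gam * lam)"
      using Suc.prems by linarith
  qed
  have "D \<subseteq> (\<Union>y\<in>kids G w. (#) (last y) ` E y)"
  proof
    fix d assume d: "d \<in> D"
    then obtain p d' where p: "d = p # d'"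
      using Suc.prems(2)[OF d] by (cases d) auto
    have "(w @ [p]) @ d' \<in> saw_tree G"
      using Suc.prems(3)[OF d] p by simp
    then have "w @ [p] \<in> kids G w"
      using saw_tree_prefix[of "w @ [p]" d' G] by (simp add: children_def)
    then show "d \<in> (\<Union>y\<in>kids G w. (#) (last y) ` E y)"
      using d p by (force simp: E_def)
  qed
  then have "card D \<le> card (\<Union>y\<in>kids G w. (#) (last y) ` E y)"
    by (intro card_mono) (auto simp: finite_children fin)
  also have "\<dots> \<le> (\<Sum>y\<in>kids G w. card ((#) (last y) ` E y))"
    by (rule card_UN_le) (rule finite_children)
  also have "\<dots> = (\<Sum>y\<in>kids G w. card (E y))"
    by (simp add: card_image)
  finally have "real (card D) \<le> (\<Sum>y\<in>kids G w. real (card (E y)))"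
    by (metis of_nat_mono of_nat_sum)
  then have "x \<le> gam ^ n * ((\<Sum>y\<in>kids G w. real (card (E y))) * eps)"
    unfolding x_def using gam eps by (intro mult_left_mono mult_right_mono) auto
  also have "\<dots> = (\<Sum>y\<in>kids G w. gam ^ n * (card (E y) * eps))"
    by (simp add: sum_distrib_left sum_distrib_right)
  also have "\<dots> \<le> (\<Sum>y\<in>kids G w. escape_upto (n + k) lam G y)"
    by (intro sum_mono IH)
  finally have "series_step (lam * x) \<le> escape_upto (Suc n + k) lam G w"
    using lam x0 by (simp add: series_step_mono mult_left_mono)
  moreover have "gam * x \<le> series_step (lam * x)"
  proof -
    have "x \<le> max 1 gam ^ Suc n * (card D * eps)"
    proof -
      have "gam ^ n \<le> max 1 gam ^ n"
        using gam by (intro power_mono) auto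
      also have "\<dots> \<le> max 1 gam ^ Suc n"
        by (intro power_increasing) auto
      finally show ?thesis
        unfolding x_def using eps by (intro mult_right_mono) auto
    qed
    then have "x \<le> (lam - gam) / (gam * lam)"
      using Suc.prems by linarith
    \<comment> \<open>For \<open>x > 0\<close> this is equivalent to
      \<open>gam * x \<le> series_step (lam * x)\<close>; it explains the right side of the
      smallness condition.\<close>
    then have "gam * (1 + lam * x) \<le> lam"
      using gam lam by (simp add: field_simps)
    then have "gam * (1 + lam * x) * x \<le> lam * x"
      using x0 by (rule mult_right_mono)
    moreover have "0 < 1 + lam * x"
      using lam x0 by (simp add: add_pos_nonneg)
    ultimately show ?thesis
      by (simp add: series_step_def field_simps)
  qed
  ultimately show ?case
    by (simp add: x_def mult.assoc)
qed

section \<open>Concatenating bridges inside the quadrant\<close>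

definition bridges_len :: "nat \<Rightarrow> site list set" where
  "bridges_len n = {w \<in> bridges. length w = Suc n}"

definition rising_bridges :: "nat \<Rightarrow> site list set" where
  "rising_bridges n = {w \<in> bridges_len n. 0 \<le> snd (last w)}"

lemma finite_bridges_len: "finite (bridges_len n)"
  by (rule finite_saws[of _ plane "Suc n"])
    (use bridges_subset half_walks_subset in \<open>auto simp: bridges_len_def\<close>)

text \<open>Changing the sign of the ordinates maps bridges to bridges, and a bridge or its mirror
  image is rising.\<close>

lemma card_bridges_le_rising: "card (bridges_len n) \<le> 2 * card (rising_bridges n)"
proof -
  define h where "h p = (fst p, - snd p)" for p :: site
  have hh: "h (h p) = p" for p
    by (simp add: h_def)
  have b: "map h w \<in> bridges_len n" if w: "w \<in> bridges_len n" for w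
  proof -
    have "w \<noteq> []" "hd w = (0, 0)" "saw_path w" "\<forall>p\<in>set (tl w). 0 < fst p"
      "\<forall>p\<in>set w. fst p \<le> fst (last w)" "length w = Suc n"
      using w by (auto simp: bridges_len_def bridges_def half_walks_def saw_tree_plane_iff)
    moreover from this have "saw_path (map h w)"
      by (intro saw_path_map) (auto simp: inj_def h_def lattice_adj_def)
    ultimately show ?thesis
      by (auto simp: bridges_len_def bridges_def half_walks_def saw_tree_plane_iff hd_map last_map h_def
          simp flip: map_tl)
  qed
  have "bridges_len n \<subseteq> rising_bridges n \<union> map h ` rising_bridges n"
  proof
    fix w assume w: "w \<in> bridges_len n"
    show "w \<in> rising_bridges n \<union> map h ` rising_bridges n"
    proof (cases "0 \<le> snd (last w)")
      case True
      then show ?thesis using w by (simp add: rising_bridges_def)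
    next
      case False
      have "w \<noteq> []"
        using w by (auto simp: bridges_len_def)
      then have "map h w \<in> rising_bridges n"
        using b[OF w] False by (simp add: rising_bridges_def last_map h_def)
      moreover have "w = map h (map h w)"
        by (simp add: comp_def hh)
      ultimately show ?thesis by blast
    qed
  qed
  moreover have fin: "finite (rising_bridges n)"
    using finite_bridges_len by (simp add: rising_bridges_def)
  ultimately have "card (bridges_len n) \<le> card (rising_bridges n \<union> map h ` rising_bridges n)"
    by (intro card_mono) auto
  also have "\<dots> \<le> card (rising_bridges n) + card (map h ` rising_bridges n)"
    by (rule card_Un_le)
  also have "\<dots> \<le> 2 * card (rising_bridges n)"
    using card_image_le[OF fin, of "map h"] by simp
  finally show ?thesis .
qed

text \<open>The walks to which every rising bridge of length \<open>n\<close> can be appended inside the quadrant.\<close>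

definition ready :: "nat \<Rightarrow> site list set" where
  "ready n = {w \<in> saw_tree quadrant. int n \<le> snd (last w) \<and> (\<forall>p\<in>set w. fst p \<le> fst (last w))}"

text \<open>The bridge runs strictly to the right of all earlier sites, hence avoids them. Its
  \<open>n\<close> steps descend by at most \<open>n\<close>, so they stay in the quadrant, and it
  ends no lower than it starts.\<close>

lemma ready_append_bridge:
  assumes w: "w \<in> ready n" and b: "b \<in> rising_bridges n"
  shows "w @ map (\<lambda>p. p + last w) (tl b) \<in> ready n"
proof (cases "n = 0")
  case True
  then have "tl b = []"
    using b by (simp add: rising_bridges_def bridges_len_def flip: length_0_conv)
  then show ?thesis using w by simp
next
  case False
  have w': "w \<noteq> []" "hd w = (0, 0)" "set w \<subseteq> quadrant" "distinct w" "successively lattice_adj w"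
    "int n \<le> snd (last w)" "\<And>p. p \<in> set w \<Longrightarrow> fst p \<le> fst (last w)"
    using w by (auto simp: ready_def saw_tree_def)
  have b': "b \<in> saw_tree plane" "length b = Suc n" "hd b = (0, 0)" "saw_path b"
    "\<And>p. p \<in> set (tl b) \<Longrightarrow> 0 < fst p" "\<And>p. p \<in> set b \<Longrightarrow> fst p \<le> fst (last b)" "0 \<le> snd (last b)"
    using b by (auto simp: rising_bridges_def bridges_len_def bridges_def half_walks_def saw_tree_plane_iff)
  obtain t where t: "b = (0, 0) # t" "t \<noteq> []" "length t = n"
    using b'(2,3) False by (cases b) auto
  have "set (map (\<lambda>p. p + last w) t) \<subseteq> quadrant"
  proof
    fix q assume "q \<in> set (map (\<lambda>p. p + last w) t)"
    then obtain p where p: "q = p + last w" "p \<in> set t" by auto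
    have "- int n \<le> snd p"
      using radius_lt_length[OF b'(1), of p] p t by (auto simp: radius_def)
    moreover have "0 \<le> fst (last w)"
      using subsetD[OF w'(3) last_in_set[OF w'(1)]] by (simp add: quadrant_def)
    ultimately show "q \<in> quadrant"
      using b'(5)[of p] p t w'(6) by (auto simp: quadrant_def)
  qed
  moreover have "distinct (w @ map (\<lambda>p. p + last w) t)"
  proof -
    have "p + last w \<notin> set w" if "p \<in> set t" for p
      using w'(7)[of "p + last w"] b'(5)[of p] that t by auto
    moreover have "distinct t"
      using b'(4) t by (simp add: saw_path_def)
    moreover have "inj_on (\<lambda>p. p + last w) (set t)"
      using inj_translate by (rule inj_on_subset) simp
    ultimately show ?thesis
      using w'(4) by (auto simp: distinct_map)
  qed
  moreover have "successively lattice_adj (w @ map (\<lambda>p. p + last w) t)"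
  proof -
    have "saw_path (map (\<lambda>p. p + last w) t)"
      using b'(4) saw_path_appendD(2)[of "[(0, 0)]" t] t by (intro saw_path_translate) simp
    moreover have "lattice_adj (0, 0) (hd t)"
      using b'(4) t by (cases t) (auto simp: saw_path_def)
    then have "lattice_adj (last w) (hd (map (\<lambda>p. p + last w) t))"
      using t by (auto simp: hd_map lattice_adj_def)
    ultimately show ?thesis
      using w'(5) by (auto simp: successively_append_iff saw_path_def)
  qed
  ultimately have "w @ map (\<lambda>p. p + last w) t \<in> saw_tree quadrant"
    using w' by (auto simp: saw_tree_def)
  moreover have "last (w @ map (\<lambda>p. p + last w) t) = last b + last w"
    using t by (simp add: last_map)
  moreover have "fst p \<le> fst (last b + last w)" if "p \<in> set (w @ map (\<lambda>p. p + last w) t)" for p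
  proof (cases "p \<in> set w")
    case True
    then show ?thesis
      using w'(7)[of p] b'(5)[of "last b"] t by auto
  next
    case False
    then have "p \<in> (\<lambda>p. p + last w) ` set t"
      using that by simp
    then obtain p' where "p = p' + last w" "p' \<in> set t"
      by blast
    then show ?thesis
      using b'(6)[of p'] t(1) by simp
  qed
  ultimately show ?thesis
    using w'(6) b'(7) t by (simp add: ready_def)
qed

text \<open>The concatenations of rising bridges branch so much that
  \<open>escape_upto_block\<close> reproduces the lower bound \<open>eps\<close> every
  \<open>n\<close> levels; it therefore survives at all depths.\<close>

lemma escape_ready_pos:
  fixes lam gam :: real
  assumes n: "1 \<le> n" and gam: "0 < gam" "gam < lam" and many: "1 \<le> gam ^ n * card (rising_bridges n)"
  obtains eps where "0 < eps" "\<And>w. w \<in> ready n \<Longrightarrow> eps \<le> escape lam quadrant w"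
proof -
  define c where "c = real (card (rising_bridges n))"
  define eta where "eta = (lam - gam) / (gam * lam)"
  \<comment> \<open>The value 1 is the bound at depth 0, the other one is the smallness that
    \<open>escape_upto_block\<close> asks for.\<close>
  define eps where "eps = min 1 (eta / (max 1 gam ^ n * c))"
  have lam: "0 < lam" using gam by linarith
  have fin: "finite (rising_bridges n)"
    using finite_bridges_len by (simp add: rising_bridges_def)
  have c: "0 < c"
    using many by (cases "card (rising_bridges n) = 0") (auto simp: c_def)
  have eta: "0 < eta"
    using gam lam by (simp add: eta_def)
  have M: "0 < max 1 gam ^ n * c"
    using c by simp
  have eps: "0 < eps" "eps \<le> 1"
    using eta M by (auto simp: eps_def)
  have "eps \<le> eta / (max 1 gam ^ n * c)"
    by (simp add: eps_def)
  then have small: "max 1 gam ^ n * (c * eps) \<le> eta"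
    using M by (simp add: pos_le_divide_eq mult_ac)
  have step: "eps \<le> escape_upto (n * k) lam quadrant w" if "w \<in> ready n" for k w
    using that
  proof (induction k arbitrary: w)
    case 0
    then show ?case using eps by simp
  next
    case (Suc k)
    define D where "D = (\<lambda>b. map (\<lambda>p. p + last w) (tl b)) ` rising_bridges n"
    have inj: "inj_on (\<lambda>b. map (\<lambda>p. p + last w) (tl b)) (rising_bridges n)"
    proof (rule inj_onI)
      fix b b' assume b: "b \<in> rising_bridges n" "b' \<in> rising_bridges n"
        and eq: "map (\<lambda>p. p + last w) (tl b) = map (\<lambda>p. p + last w) (tl b')"
      have "tl b = tl b'"
        using eq inj_map_eq_map[OF inj_translate] by blast
      moreover have "b \<noteq> []" "b' \<noteq> []" "hd b = hd b'"
        using b by (auto simp: rising_bridges_def bridges_len_def bridges_def half_walks_def saw_tree_def)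
      ultimately show "b = b'"
        by (metis list.collapse)
    qed
    have card: "card D = card (rising_bridges n)"
      unfolding D_def using inj by (rule card_image)
    have ready: "w @ d \<in> ready n" if "d \<in> D" for d
      using that ready_append_bridge[OF Suc.prems] by (auto simp: D_def)
    have "eps \<le> gam ^ n * c * eps"
      using many eps by (simp add: c_def)
    also have "\<dots> = gam ^ n * (card D * eps)"
      by (simp add: card c_def)
    also have "\<dots> \<le> escape_upto (n + n * k) lam quadrant w"
    proof (rule escape_upto_block[OF gam])
      show "0 \<le> eps" using eps by simp
      show "finite D" using fin by (simp add: D_def)
      show "length d = n" if "d \<in> D" for d
        using that by (auto simp: D_def rising_bridges_def bridges_len_def)
      show "w @ d \<in> saw_tree quadrant" if "d \<in> D" for d
        using ready[OF that] by (simp add: ready_def)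
      show "w \<noteq> []"
        using Suc.prems by (auto simp: ready_def saw_tree_def)
      show "eps \<le> escape_upto (n * k) lam quadrant (w @ d)" if "d \<in> D" for d
        using Suc.IH[OF ready[OF that]] .
      show "max 1 gam ^ n * (card D * eps) \<le> (lam - gam) / (gam * lam)"
        using small by (simp add: card c_def eta_def)
    qed
    finally show ?case by simp
  qed
  have "eps \<le> escape lam quadrant w" if w: "w \<in> ready n" for w
  proof (rule LIMSEQ_le_const[OF escape_upto_LIMSEQ], use lam in simp, intro exI allI impI)
    fix k
    have "decseq (\<lambda>k. escape_upto k lam quadrant w)"
      using lam by (intro decseq_SucI escape_upto_Suc_le) simp
    \<comment> \<open>The bound is known at multiples of \<open>n\<close>; since
      \<open>k \<le> n * k\<close> and the iterates decrease, it holds at every depth.\<close>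
    then have "escape_upto (n * k) lam quadrant w \<le> escape_upto k lam quadrant w"
      by (rule decseqD) (use n in simp)
    then show "eps \<le> escape_upto k lam quadrant w"
      using step[OF w, of k] by linarith
  qed
  then show ?thesis
    using that eps by blast
qed

section \<open>Transience above the radius of convergence\<close>

lemma escape_pos_of_kid:
  assumes lam: "0 < lam" and y: "y \<in> kids G x" "0 < escape lam G y"
  shows "0 < escape lam G x"
proof -
  have "0 < (\<Sum>y\<in>kids G x. escape lam G y)"
    using lam y by (intro sum_pos2[of _ y] finite_children escape_nonneg) auto
  then show ?thesis
    using lam by (subst escape_rec) (auto intro: series_step_pos)
qed

definition vertical_walk :: "nat \<Rightarrow> site list" where
  "vertical_walk n = map (\<lambda>i. (0, int i)) [0..<Suc n]"

lemma vertical_walk_Suc: "vertical_walk (Suc n) = vertical_walk n @ [(0, int (Suc n))]"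
  by (simp add: vertical_walk_def)

lemma vertical_walk_in_quadrant: "vertical_walk n \<in> saw_tree quadrant"
proof (induction n)
  case 0
  show ?case by (simp add: vertical_walk_def saw_tree_def quadrant_def)
next
  case (Suc n)
  have "last (vertical_walk n) = (0, int n)" "(0, int (Suc n)) \<notin> set (vertical_walk n)"
    by (auto simp: vertical_walk_def)
  then show ?case
    using Suc unfolding vertical_walk_Suc
    by (auto simp: saw_tree_def successively_append_iff lattice_adj_def quadrant_def)
qed

lemma vertical_walk_0: "vertical_walk 0 = tree_root"
  by (simp add: vertical_walk_def tree_root_def)

lemma vertical_walk_kid: "vertical_walk (Suc n) \<in> kids quadrant (vertical_walk n)"
  using vertical_walk_in_quadrant[of "Suc n"] by (simp add: children_def vertical_walk_Suc)

lemma vertical_walk_ready: "vertical_walk n \<in> ready n"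
  using vertical_walk_in_quadrant[of n] by (auto simp: ready_def) (auto simp: vertical_walk_def)

lemma escape_quadrant_pos:
  assumes lam0: "0 < lam0" "lam0 < lam"
    and div: "\<not> summable (\<lambda>n. real (card {w \<in> saw_tree plane. length w = Suc n}) * lam0 ^ n)"
  shows "0 < escape lam quadrant tree_root"
proof -
  \<comment> \<open>Being above \<open>lam0\<close>, \<open>gam\<close> gives a convergent geometric
    series of ratio \<open>lam0 / gam\<close>; being below \<open>lam\<close>, it leaves the room
    that \<open>escape_ready_pos\<close> needs.\<close>
  define gam where "gam = (lam0 + lam) / 2"
  have gam: "0 < gam" "lam0 < gam" "gam < lam"
    using lam0 by (auto simp: gam_def)
  have "\<exists>n\<ge>1. 1 \<le> gam ^ n * card (rising_bridges n)"
  proof (rule ccontr)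
    assume no: "\<not> ?thesis"
    have "summable (\<lambda>n. real (card (bridges_len n)) * lam0 ^ n)"
    proof (rule summable_comparison_test)
      show "summable (\<lambda>n. 2 * (lam0 / gam) ^ n)"
        using lam0 gam by (intro summable_mult summable_geometric) simp
      show "\<exists>N. \<forall>n\<ge>N. norm (real (card (bridges_len n)) * lam0 ^ n) \<le> 2 * (lam0 / gam) ^ n"
      proof (intro exI allI impI)
        fix n :: nat assume n: "1 \<le> n"
        have "gam ^ n * card (rising_bridges n) \<le> 1"
          using no n by force
        then have "real (card (rising_bridges n)) \<le> 1 / gam ^ n"
          using gam by (simp add: field_simps)
        then have "real (card (bridges_len n)) \<le> 2 * (1 / gam ^ n)"
          using card_bridges_le_rising[of n] by linarith
        then have "real (card (bridges_len n)) * lam0 ^ n \<le> 2 * (1 / gam ^ n) * lam0 ^ n"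
          using lam0 by (intro mult_right_mono) auto
        then show "norm (real (card (bridges_len n)) * lam0 ^ n) \<le> 2 * (lam0 / gam) ^ n"
          using lam0 by (simp add: power_divide)
      qed
    qed
    then show False
      using summable_saws_of_bridges[OF lam0(1)] div by (simp add: bridges_len_def)
  qed
  then obtain n where n: "1 \<le> n" "1 \<le> gam ^ n * card (rising_bridges n)" by blast
  obtain eps where "0 < eps" "\<And>w. w \<in> ready n \<Longrightarrow> eps \<le> escape lam quadrant w"
    using escape_ready_pos[OF n(1) gam(1,3) n(2)] by blast
  then have "0 < escape lam quadrant (vertical_walk n)"
    using vertical_walk_ready by (meson less_le_trans)
  \<comment> \<open>The vertical walk is ready at height \<open>n\<close>; positivity is passed from
    child to parent down to the root.\<close>
  then have "0 < escape lam quadrant (vertical_walk 0)"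
  proof (induction n)
    case (Suc n)
    have "0 < escape lam quadrant (vertical_walk n)"
      by (rule escape_pos_of_kid[OF _ vertical_walk_kid]) (use lam0 Suc.prems in auto)
    then show ?case by (rule Suc.IH)
  qed
  then show ?thesis
    by (simp add: vertical_walk_0)
qed

text \<open>First moment bound: iterate \<open>series_step u \<le> u\<close> through
  \<open>n\<close> generations.\<close>

lemma escape_root_le_level:
  assumes lam: "0 \<le> lam"
  shows "escape lam G tree_root \<le> lam ^ n * (\<Sum>w | w \<in> saw_tree G \<and> length w = Suc n. escape lam G w)"
proof (cases "tree_root \<in> saw_tree G")
  case False
  then have "saw_tree G = {}"
    by (auto simp: saw_tree_def tree_root_def dest: hd_in_set)
  then show ?thesis
    using escape_rec[OF lam, of G tree_root] by (simp add: children_def series_step_def)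
next
  case True
  define L where "L n = {w \<in> saw_tree G. length w = Suc n}" for n
  have fin: "finite (L n)" for n
    by (rule finite_saws[of _ G "Suc n"]) (auto simp: L_def)
  have "L 0 = {tree_root}"
    using True by (auto simp: L_def saw_tree_def tree_root_def length_Suc_conv)
  have "(\<Sum>w\<in>L n. escape lam G w) \<le> lam * (\<Sum>w\<in>L (Suc n). escape lam G w)" for n
  proof -
    have "L (Suc n) = (\<Union>w\<in>L n. kids G w)"
    proof (intro set_eqI iffI)
      fix w assume w: "w \<in> L (Suc n)"
      then have "w = butlast w @ [last w]" "butlast w \<noteq> []" "length (butlast w) = Suc n"
        by (auto simp: L_def simp flip: length_0_conv)
      moreover from this have "butlast w \<in> L n"
        using w saw_tree_prefix[of "butlast w" "[last w]" G] by (simp add: L_def)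
      ultimately show "w \<in> (\<Union>w\<in>L n. kids G w)"
        using w unfolding L_def children_def by blast
    qed (auto simp: L_def children_def)
    then have "(\<Sum>w\<in>L (Suc n). escape lam G w) = (\<Sum>w\<in>L n. \<Sum>y\<in>kids G w. escape lam G y)"
      using fin by (simp only:) (intro sum.UNION_disjoint ballI impI finite_children, auto simp: children_def)
    moreover have "escape lam G w \<le> lam * (\<Sum>y\<in>kids G w. escape lam G y)" for w
      using lam by (subst escape_rec) (auto intro!: series_step_bounds mult_nonneg_nonneg sum_nonneg escape_nonneg)
    ultimately show ?thesis
      by (simp add: sum_distrib_left sum_mono)
  qed
  then have "escape lam G tree_root \<le> lam ^ n * (\<Sum>w\<in>L n. escape lam G w)"
  proof (induction n)
    case 0
    then show ?case using \<open>L 0 = {tree_root}\<close> by simp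
  next
    case (Suc n)
    have "lam ^ n * (\<Sum>w\<in>L n. escape lam G w) \<le> lam ^ n * (lam * (\<Sum>w\<in>L (Suc n). escape lam G w))"
      using lam Suc.prems by (intro mult_left_mono) auto
    then show ?case
      using Suc by (simp add: mult_ac)
  qed
  then show ?thesis
    by (simp add: L_def)
qed

lemma escape_plane_eq_0:
  assumes lam: "0 < lam" and sum: "summable (\<lambda>n. real (card {w \<in> saw_tree plane. length w = Suc n}) * lam ^ n)"
  shows "escape lam plane tree_root = 0"
proof -
  have "escape lam plane tree_root \<le> real (card {w \<in> saw_tree plane. length w = Suc n}) * lam ^ n" for n
  proof -
    have "escape lam plane tree_root \<le>
        lam ^ n * (\<Sum>w | w \<in> saw_tree plane \<and> length w = Suc n. escape lam plane w)"
      using lam by (intro escape_root_le_level) simp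
    also have "\<dots> \<le> lam ^ n * (\<Sum>w | w \<in> saw_tree plane \<and> length w = Suc n. 1)"
      using lam by (intro mult_left_mono sum_mono escape_le_1) auto
    finally show ?thesis by (simp add: mult.commute)
  qed
  then have "escape lam plane tree_root \<le> 0"
    using summable_LIMSEQ_zero[OF sum] by (intro LIMSEQ_le_const) auto
  then show ?thesis
    using escape_nonneg[of lam plane tree_root] lam by simp
qed

text \<open>There is a straight walk of every length. The bound ensures that the supremum defining
  the critical value is finite.\<close>

lemma summable_saws_bounded:
  assumes "0 \<le> lam" "summable (\<lambda>n. real (card {w \<in> saw_tree plane. length w = Suc n}) * lam ^ n)"
  shows "lam \<le> 1"
proof (rule ccontr)
  assume gt: "\<not> lam \<le> 1"
  have "1 \<le> real (card {w \<in> saw_tree plane. length w = Suc n}) * lam ^ n" for n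
  proof -
    have "vertical_walk n \<in> {w \<in> saw_tree plane. length w = Suc n}"
      using vertical_walk_in_quadrant[of n] by (auto simp: saw_tree_def plane_def vertical_walk_def)
    moreover have "finite {w \<in> saw_tree plane. length w = Suc n}"
      by (rule finite_saws[of _ plane "Suc n"]) auto
    ultimately have "1 \<le> card {w \<in> saw_tree plane. length w = Suc n}"
      by (metis card_gt_0_iff empty_iff Suc_leI One_nat_def)
    moreover have "1 \<le> lam ^ n"
      using gt by simp
    ultimately have "1 * 1 \<le> real (card {w \<in> saw_tree plane. length w = Suc n}) * lam ^ n"
      by (intro mult_mono) auto
    then show ?thesis by simp
  qed
  then have "(1 :: real) \<le> 0"
    using summable_LIMSEQ_zero[OF assms(2)] by (intro LIMSEQ_le_const) auto
  then show False by simp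
qed

theorem theorem3:
  shows "\<exists>lam_c :: real.
    is_critical_value (saw_tree quadrant) lam_c \<and>
    is_critical_value (saw_tree half_plane) lam_c \<and>
    is_critical_value (saw_tree plane) lam_c \<and>
    continuous_on {lam_c<..} (\<lambda>t. effective_conductance t (saw_tree quadrant)) \<and>
    continuous_on {lam_c<..} (\<lambda>t. effective_conductance t (saw_tree half_plane)) \<and>
    continuous_on {lam_c<..} (\<lambda>t. effective_conductance t (saw_tree plane))"
proof -
  \<comment> \<open>The supremum of \<open>S\<close> is the radius of convergence of the generating
    function of plane walks.\<close>
  define S where "S = {lam. 0 \<le> lam \<and> summable (\<lambda>n. real (card {w \<in> saw_tree plane. length w = Suc n}) * lam ^ n)}"
  define c where "c = Sup S"
  have S0: "0 \<in> S"
    by (simp add: S_def power_0_left if_distrib cong: if_cong)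
  have bdd: "bdd_above S"
    using summable_saws_bounded by (intro bdd_aboveI[of _ 1]) (auto simp: S_def)
  have c0: "0 \<le> c"
    unfolding c_def using S0 bdd by (rule cSup_upper)
  have below: "escape lam plane tree_root = 0" if lam: "0 < lam" "lam < c" for lam
  proof -
    obtain l where l: "l \<in> S" "lam < l"
      using lam(2) S0 bdd unfolding c_def by (metis empty_iff less_cSup_iff)
    have "escape lam plane tree_root \<le> escape l plane tree_root"
      using lam l by (intro escape_mono) auto
    also have "\<dots> = 0"
      using lam l by (intro escape_plane_eq_0) (auto simp: S_def)
    finally show ?thesis
      using escape_nonneg[of lam plane tree_root] lam by simp
  qed
  have above: "0 < escape lam quadrant tree_root" if lam: "c < lam" for lam
  proof (rule escape_quadrant_pos)
    show "0 < (c + lam) / 2" "(c + lam) / 2 < lam"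
      using lam c0 by auto
    \<comment> \<open>\<open>escape_quadrant_pos\<close> needs divergence at some parameter strictly
      below \<open>lam\<close>; the midpoint serves.\<close>
    have "(c + lam) / 2 \<notin> S"
      using lam cSup_upper[OF _ bdd, of "(c + lam) / 2"] by (auto simp: c_def[symmetric])
    then show "\<not> summable (\<lambda>n. real (card {w \<in> saw_tree plane. length w = Suc n}) * ((c + lam) / 2) ^ n)"
      using lam c0 by (simp add: S_def)
  qed
  \<comment> \<open>One argument serves the three lattices: vanishing in the plane gives recurrence
    below \<open>c\<close>, positivity in the quadrant gives transience above it, and
    \<open>G\<close> lies in between.\<close>
  have main: "is_critical_value (saw_tree G) c \<and> continuous_on {c<..} (\<lambda>t. effective_conductance t (saw_tree G))"
    if G: "quadrant \<subseteq> G" "outward_closed G" for G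
  proof -
    have root: "tree_root \<in> saw_tree H" if "quadrant \<subseteq> H" for H
      using vertical_walk_in_quadrant[of 0] that by (auto simp: vertical_walk_0 saw_tree_def)
    have kid: "kids G tree_root \<noteq> {}"
      using vertical_walk_kid[of 0] G(1) by (auto simp: vertical_walk_0 children_def saw_tree_def)
    have le: "escape lam quadrant tree_root \<le> escape lam G tree_root"
      "escape lam G tree_root \<le> escape lam plane tree_root" if "0 < lam" for lam
      using that G root by (auto intro!: escape_mono_graph simp: plane_def)
    have "recurrent lam (saw_tree G)" if "0 < lam" "lam < c" for lam
      using below[OF that] le[of lam] that escape_nonneg[of lam G tree_root]
      by (simp add: recurrent_iff root[OF G(1)] kid)
    moreover have "transient lam (saw_tree G)" if "0 < lam" "c < lam" for lam
      using above[of lam] le[of lam] that by (simp add: transient_def recurrent_iff root[OF G(1)] kid)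
    ultimately have "is_critical_value (saw_tree G) c"
      using c0 by (simp add: is_critical_value_def)
    moreover have "continuous_on {c<..} (\<lambda>t. effective_conductance t (saw_tree G))"
    proof -
      have "continuous_on {c<..} (\<lambda>t. \<Sum>y\<in>kids G tree_root. escape t G y)"
      proof (intro continuous_on_sum)
        fix y assume y: "y \<in> kids G tree_root"
        \<comment> \<open>Take the midpoint as \<open>lam1\<close>: it is still above
          \<open>c\<close>, so the quadrant value there is positive.\<close>
        have "isCont (\<lambda>t. escape t G y) lam" if "c < lam" for lam
          using that c0 above[of "(c + lam) / 2"] y kids_subset
          by (intro escape_isCont[OF G(2), of "(c + lam) / 2"]) auto
        then show "continuous_on {c<..} (\<lambda>t. escape t G y)"
          by (simp add: continuous_on_eq_continuous_at)
      qed
      then show ?thesis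
        by (rule continuous_on_eq) (use c0 root[OF G(1)] kid in \<open>auto simp: effective_conductance_eq\<close>)
    qed
    ultimately show ?thesis by blast
  qed
  show ?thesis
    using main[of quadrant] main[of half_plane] main[of plane]
    by (intro exI[of _ c])
      (auto simp: outward_closed_quadrant outward_closed_half_plane outward_closed_plane,
       auto simp: quadrant_def half_plane_def plane_def)
qed

end
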